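(* Let $X$ be an infinite-dimensional (real or complex) Banach space which is separable, or more generally which has a closed, separable, infinite-dimensional subspace that is complemented in $X$. Then the set $\mathcal{A}_X$ is dense in $\mathcal{L}(X)$ for the strong operator topology.
   Context: $\mathcal{L}(X)$ is the space of bounded linear operators on $X$. For $R\in\mathcal{L}(X)$ put $$A_R=\{x\in X:\ \|R^t x\|\to\infty \text{ as } t\to\infty\},\qquad B_R=\{x\in X:\ \liminf_{t\to\infty}\|R^t x-x\|=0\},$$ where $t$ ranges over the non-negative integers. $\mathcal{A}_X$ is the set of all $R\in\mathcal{L}(X)$ such that $A_R$ and $B_R$ both have non-empty interior and $\{A_R,B_R\}$ is a partition of $X$. *)

theory Defs
  imports "HOL-Analysis.Analysis" "HOL-Library.Disjoint_Sets"
begin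

(* The library has no class of complex normed spaces.  A normed space over a field 'k
   (used for 'k = real and 'k = complex) is a type of class real_normed_vector with a scalar
   multiplication by 'k that extends the one by the reals and is compatible with the norm.
   Every complex normed space is of this form, with its underlying real structure.
   A Banach space over 'k is obtained when the type belongs to class banach. *)

locale normed_space_over = vector_space sc
  for sc :: "'k::real_normed_field \<Rightarrow> 'a::real_normed_vector \<Rightarrow> 'a" +
  assumes scale_of_real: "sc (of_real r) x = r *\<^sub>R x"
    and norm_scale: "norm (sc c x) = norm c * norm x"

lemma normed_space_over_scaleR:
  "normed_space_over (scaleR :: real \<Rightarrow> 'a::real_normed_vector \<Rightarrow> 'a)"
  by unfold_locales (auto simp: algebra_simps)

definition infinite_dim :: "('k::field \<Rightarrow> 'a::ab_group_add \<Rightarrow> 'a) \<Rightarrow> 'a set \<Rightarrow> bool" where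
  "infinite_dim sc Y \<longleftrightarrow> \<not> (\<exists>B. finite B \<and> module.span sc B = Y)"

(* The elements of type blinfun are the bounded real-linear operators; L(X) consists of those
   that are linear over 'k. *)

definition bounded_ops ::
  "('k \<Rightarrow> 'a::real_normed_vector \<Rightarrow> 'a) \<Rightarrow> ('a \<Rightarrow>\<^sub>L 'a) set" where
  "bounded_ops sc = {R. \<forall>c x. blinfun_apply R (sc c x) = sc c (blinfun_apply R x)}"

lemma bounded_ops_scaleR:
  "bounded_ops (scaleR :: real \<Rightarrow> 'a::real_normed_vector \<Rightarrow> 'a) = UNIV"
  by (simp add: bounded_ops_def blinfun.scaleR_right)

definition SOT ::
  "('k \<Rightarrow> 'a::real_normed_vector \<Rightarrow> 'a) \<Rightarrow> ('a \<Rightarrow>\<^sub>L 'a) topology" where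
  "SOT sc = subtopology strong_operator_topology (bounded_ops sc)"

definition complemented ::
  "('k \<Rightarrow> 'a::real_normed_vector \<Rightarrow> 'a) \<Rightarrow> 'a set \<Rightarrow> bool" where
  "complemented sc Y \<longleftrightarrow>
     (\<exists>P \<in> bounded_ops sc. P o\<^sub>L P = P \<and> range (blinfun_apply P) = Y)"

definition A_set :: "('a::real_normed_vector \<Rightarrow>\<^sub>L 'a) \<Rightarrow> 'a set" where
  "A_set R = {x. filterlim (\<lambda>t. norm ((blinfun_apply R ^^ t) x)) at_top sequentially}"

definition B_set :: "('a::real_normed_vector \<Rightarrow>\<^sub>L 'a) \<Rightarrow> 'a set" where
  "B_set R = {x. liminf (\<lambda>t. ereal (norm ((blinfun_apply R ^^ t) x - x))) = 0}"

definition A_class ::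
  "('k \<Rightarrow> 'a::real_normed_vector \<Rightarrow> 'a) \<Rightarrow> ('a \<Rightarrow>\<^sub>L 'a) set" where
  "A_class sc = {R \<in> bounded_ops sc.
     interior (A_set R) \<noteq> {} \<and> interior (B_set R) \<noteq> {} \<and> partition_on UNIV {A_set R, B_set R}}"

(* Covers the degenerate reading A_set R = B_set R of the two-element set above. *)

lemma A_set_B_set_disjoint: "A_set R \<inter> B_set R = {}"
proof -
  have False if A: "x \<in> A_set R" and B: "x \<in> B_set R" for x
  proof -
    have "\<forall>\<^sub>F t in sequentially. norm x + 1 \<le> norm ((blinfun_apply R ^^ t) x)"
      using A by (auto simp: A_set_def filterlim_at_top)
    then have "\<forall>\<^sub>F t in sequentially. 1 \<le> ereal (norm ((blinfun_apply R ^^ t) x - x))"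
    proof eventually_elim
      case (elim t)
      have "norm ((blinfun_apply R ^^ t) x) - norm x \<le> norm ((blinfun_apply R ^^ t) x - x)"
        by (rule norm_triangle_ineq2)
      with elim have "1 \<le> norm ((blinfun_apply R ^^ t) x - x)" by linarith
      then show ?case by simp
    qed
    then have "1 \<le> liminf (\<lambda>t. ereal (norm ((blinfun_apply R ^^ t) x - x)))"
      by (rule Liminf_bounded)
    with B show False by (simp add: B_set_def)
  qed
  then show ?thesis by blast
qed

(* The hypothesis on the Banach space X, which is the whole type 'a. *)

definition sep_or_sep_complemented ::
  "('k::field \<Rightarrow> 'a::real_normed_vector \<Rightarrow> 'a) \<Rightarrow> bool" where
  "sep_or_sep_complemented sc \<longleftrightarrow>
     separable_space (euclidean :: 'a topology) \<or>
     (\<exists>Y. module.subspace sc Y \<and> closed Y \<and> separable_space (top_of_set Y) \<and>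
          infinite_dim sc Y \<and> complemented sc Y)"

end

theory Submission
  imports Defs
begin

text \<open>
  Let \<open>T\<close> be an operator, and let \<open>v\<^sub>j\<close> be finitely many independent vectors. Choose \<open>y\<^sub>j\<close> near
  \<open>T v\<^sub>j\<close> such that all \<open>v\<^sub>j, y\<^sub>j\<close> together are independent, and extend them to a bounded
  biorthogonal sequence, which is possible by Mazur's argument. The operator is \<open>R = J + K\<close>. Here \<open>J\<close> is the involution
  which swaps \<open>v\<^sub>j\<close> and \<open>y\<^sub>j\<close>. The nuclear operator \<open>K\<close> makes \<open>R\<close> rotate the plane of two vectors
  \<open>a\<^sub>n, b\<^sub>n\<close> by the angle \<open>2 \<pi> / m\<^sub>n\<^sub>+\<^sub>1\<close> and add \<open>\<epsilon>\<^sub>n (p x - w\<^sub>n q x) a\<^sub>n\<close>, where \<open>p, q\<close> are two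
  coordinates, the \<open>w\<^sub>n\<close> are dense in the unit disc, \<open>m\<^sub>n\<close> divides \<open>m\<^sub>n\<^sub>+\<^sub>1\<close>, and
  \<open>\<epsilon>\<^sub>n = c\<^sub>n / m\<^sub>n\<close> with \<open>c\<^sub>n\<close> tending slowly to infinity.

  At time \<open>m\<^sub>N\<close> the blocks below \<open>N\<close> have returned, the blocks above \<open>N\<close> have hardly moved, and block
  \<open>N\<close> has moved by about \<open>c\<^sub>N \<bar>p x - w\<^sub>N q x\<bar>\<close>. If \<open>\<bar>p x\<bar> \<le> \<bar>q x\<bar>\<close>, this is small for infinitely many
  \<open>N\<close>, so \<open>x\<close> is recurrent. If \<open>\<bar>p x\<bar> > \<bar>q x\<bar>\<close>, then for \<open>m\<^sub>n \<le> 6 t < m\<^sub>n\<^sub>+\<^sub>1\<close> the \<open>a\<^sub>n\<close>-coordinate of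
  \<open>R\<^sup>t x\<close> has size at least a constant times \<open>c\<^sub>n\<close>, so the orbit tends to infinity.
\<close>

section \<open>The Hahn--Banach theorem\<close>

text \<open>Homogeneity is stated as one inequality, the form to be checked for infima; the converse
  follows by rescaling with \<open>inverse c\<close>.\<close>

definition sublinear :: "('a::real_vector \<Rightarrow> real) \<Rightarrow> bool" where
  "sublinear p \<longleftrightarrow> (\<forall>x y. p (x + y) \<le> p x + p y) \<and> (\<forall>c x. 0 \<le> c \<longrightarrow> p (c *\<^sub>R x) \<le> c * p x)"

lemma sublinear_add: "sublinear p \<Longrightarrow> p (x + y) \<le> p x + p y"
  and sublinear_scale_le: "sublinear p \<Longrightarrow> 0 \<le> c \<Longrightarrow> p (c *\<^sub>R x) \<le> c * p x"
  by (auto simp: sublinear_def)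

lemma sublinear_0 [simp]: "sublinear p \<Longrightarrow> p 0 = 0"
  using sublinear_add[of p 0 0] sublinear_scale_le[of p 0 0] by simp

lemma sublinear_scale:
  assumes "sublinear p" "0 \<le> c"
  shows "p (c *\<^sub>R x) = c * p x"
proof (cases "c = 0")
  case False
  then have "c * p x \<le> p (c *\<^sub>R x)"
    using sublinear_scale_le[OF assms(1), of "inverse c" "c *\<^sub>R x"] assms(2)
    by (simp add: field_simps)
  then show ?thesis
    using sublinear_scale_le[OF assms] by (simp add: antisym)
qed (use assms in simp)

lemma sublinear_minus: "sublinear p \<Longrightarrow> - p (- x) \<le> p x"
  using sublinear_add[of p x "- x"] by simp

text \<open>Zorn's lemma for the reversed pointwise order: the pointwise infimum is a lower bound of
  a non-empty chain, and \<open>p\<close> serves for the empty one.\<close>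

lemma sublinear_minimal_exists:
  fixes p :: "'a::real_vector \<Rightarrow> real"
  assumes p: "sublinear p"
  shows "\<exists>q. sublinear q \<and> q \<le> p \<and> (\<forall>r. sublinear r \<and> r \<le> q \<longrightarrow> r = q)"
proof -
  define A where "A = {q. sublinear q \<and> q \<le> p}"
  have "\<exists>m\<in>A. \<forall>a\<in>A. m \<ge> a \<longrightarrow> a = m"
  proof (rule predicate_Zorn)
    show "partial_order_on A (relation_of (\<ge>) A)"
      by (auto simp: partial_order_on_def preorder_on_def refl_on_def trans_def antisym_def
          relation_of_def)
  next
    fix C assume C: "C \<in> Chains (relation_of (\<ge>) A)"
    then have CA: "C \<subseteq> A" and tot: "\<And>q r. q \<in> C \<Longrightarrow> r \<in> C \<Longrightarrow> q \<le> r \<or> r \<le> q"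
      by (auto simp: Chains_def relation_of_def)
    show "\<exists>u\<in>A. \<forall>a\<in>C. a \<ge> u"
    proof (cases "C = {}")
      case True
      then show ?thesis using p by (auto simp: A_def)
    next
      case False
      define u where "u x = (INF q\<in>C. q x)" for x
      have sub: "sublinear q" "q x \<le> p x" if "q \<in> C" for q x
        using CA that by (auto simp: A_def le_fun_def)
      \<comment> \<open>This lower bound is the same for the whole chain, so the infimum is
        finite.\<close>
      have "- p (- x) \<le> q x" if "q \<in> C" for q x
        using sublinear_minus[OF sub(1)[OF that], of x] sub(2)[OF that, of "- x"] by linarith
      then have bdd: "bdd_below ((\<lambda>q. q x) ` C)" for x
        by (auto simp: bdd_below_def)
      have u_le: "u x \<le> q x" if "q \<in> C" for q x
        unfolding u_def by (rule cINF_lower[OF bdd that])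
      have u_add: "u (x + y) \<le> u x + u y" for x y
      proof -
        \<comment> \<open>Two members of a chain are comparable, and the smaller one can replace
          both.\<close>
        have "u (x + y) \<le> q x + r y" if q: "q \<in> C" and r: "r \<in> C" for q r
        proof (cases "q \<le> r")
          case True
          then have "q y \<le> r y" by (simp add: le_fun_def)
          then show ?thesis
            using u_le[OF q, of "x + y"] sublinear_add[OF sub(1)[OF q], of x y] by linarith
        next
          case False
          then have "r x \<le> q x" using tot[OF q r] by (auto simp: le_fun_def)
          then show ?thesis
            using u_le[OF r, of "x + y"] sublinear_add[OF sub(1)[OF r], of x y] by linarith
        qed
        then have "u (x + y) - r y \<le> u x" if "r \<in> C" for r
          unfolding u_def[of x] by (intro cINF_greatest False) (use that in \<open>auto simp: algebra_simps\<close>)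
        then have "u (x + y) - u x \<le> u y"
          unfolding u_def[of y] by (intro cINF_greatest False) (auto simp: algebra_simps)
        then show ?thesis by simp
      qed
      have u_scale: "u (c *\<^sub>R x) \<le> c * u x" if "0 \<le> c" for c x
      proof (cases "c = 0")
        case True
        obtain q where "q \<in> C" using False by blast
        then show ?thesis using True u_le[of q 0] sub(1)[of q] by simp
      next
        case c: False
        have "u (c *\<^sub>R x) / c \<le> u x"
          unfolding u_def[of x]
        proof (intro cINF_greatest False)
          fix q assume "q \<in> C"
          then show "u (c *\<^sub>R x) / c \<le> q x"
            using u_le[of q "c *\<^sub>R x"] sublinear_scale[OF sub(1)[of q] that, of x] c that
            by (simp add: field_simps)
        qed
        then show ?thesis using c that by (simp add: field_simps)
      qed
      obtain q where "q \<in> C" using False by blast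
      then have "u \<le> p" using u_le sub(2) by (meson le_funI order_trans)
      then have "u \<in> A" using u_add u_scale by (auto simp: A_def sublinear_def)
      then show ?thesis using u_le by (auto simp: le_fun_def)
    qed
  qed
  then obtain m where "sublinear m" "m \<le> p" "\<forall>a\<in>A. m \<ge> a \<longrightarrow> a = m"
    by (auto simp: A_def)
  then have "\<forall>r. sublinear r \<and> r \<le> m \<longrightarrow> r = m"
    unfolding A_def by (metis (mono_tags, lifting) mem_Collect_eq order_trans)
  with \<open>sublinear m\<close> \<open>m \<le> p\<close> show ?thesis by blast
qed

text \<open>The infimum over t \<ge> 0 of p (x + t y) - t p y is again sublinear. Taking t = 0 shows
  that it lies below \<open>p\<close>, and t = 1 gives the bound at - y.\<close>

lemma sublinear_lower_at:
  fixes p :: "'a::real_vector \<Rightarrow> real"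
  assumes p: "sublinear p"
  shows "\<exists>r. sublinear r \<and> r \<le> p \<and> r (- y) \<le> - p y"
proof -
  define v where "v x t = p (x + t *\<^sub>R y) - t * p y" for x t
  define r where "r x = (INF t\<in>{0..}. v x t)" for x
  have ne: "{0::real..} \<noteq> {}" by auto
  have "- p (- x) \<le> v x t" if "0 \<le> t" for x t
    using sublinear_add[OF p, of "- x" "x + t *\<^sub>R y"] sublinear_scale[OF p that, of y]
    by (simp add: v_def)
  then have bdd: "bdd_below (v x ` {0..})" for x
    by (auto simp: bdd_below_def)
  have r_le: "r x \<le> v x t" if "0 \<le> t" for x t
    unfolding r_def by (rule cINF_lower[OF bdd]) (use that in auto)
  have r_add: "r (x + z) \<le> r x + r z" for x z
  proof -
    have "r (x + z) \<le> v x s + v z t" if "0 \<le> s" "0 \<le> t" for s t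
      using r_le[of "s + t" "x + z"] sublinear_add[OF p, of "x + s *\<^sub>R y" "z + t *\<^sub>R y"] that
      by (simp add: v_def algebra_simps)
    then have "r (x + z) - v z t \<le> r x" if "0 \<le> t" for t
      unfolding r_def[of x] by (intro cINF_greatest ne) (use that in \<open>auto simp: algebra_simps\<close>)
    then have "r (x + z) - r x \<le> r z"
      unfolding r_def[of z] by (intro cINF_greatest ne) (auto simp: algebra_simps)
    then show ?thesis by simp
  qed
  have r_scale: "r (c *\<^sub>R x) \<le> c * r x" if c: "0 \<le> c" for c x
  proof (cases "c = 0")
    case True
    then show ?thesis using r_le[of 0 0] p by (simp add: v_def)
  next
    case False
    have "r (c *\<^sub>R x) / c \<le> r x"
      unfolding r_def[of x]
    proof (intro cINF_greatest ne)
      fix t :: real assume t: "t \<in> {0..}"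
      have "v (c *\<^sub>R x) (c * t) = c * v x t"
        using sublinear_scale[OF p c, of "x + t *\<^sub>R y"] by (simp add: v_def algebra_simps)
      then show "r (c *\<^sub>R x) / c \<le> v x t"
        using r_le[of "c * t" "c *\<^sub>R x"] c t False by (simp add: field_simps)
    qed
    then show ?thesis using c False by (simp add: field_simps)
  qed
  have "r \<le> p" using r_le[of 0] by (auto simp: le_fun_def v_def)
  moreover have "r (- y) \<le> - p y" using r_le[of 1 "- y"] p by (simp add: v_def)
  moreover have "sublinear r" using r_add r_scale by (simp add: sublinear_def)
  ultimately show ?thesis by blast
qed

text \<open>Minimal sublinear functionals are linear, which gives the Hahn--Banach theorem without
  extending functionals from subspaces.\<close>

theorem Hahn_Banach_sublinear:
  fixes p :: "'a::real_vector \<Rightarrow> real"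
  assumes p: "sublinear p"
  shows "\<exists>g. linear g \<and> g \<le> p \<and> g y = p y"
proof -
  obtain r where r: "sublinear r" "r \<le> p" "r (- y) \<le> - p y"
    using sublinear_lower_at[OF p] by blast
  obtain g where g: "sublinear g" "g \<le> r" and min: "\<And>s. sublinear s \<Longrightarrow> s \<le> g \<Longrightarrow> s = g"
    using sublinear_minimal_exists[OF r(1)] by blast
  \<comment> \<open>By minimality the functional lowered in direction \<open>x\<close> is
    \<open>g\<close> itself, so \<open>g\<close> is odd. For an odd functional sublinearity becomes
    linearity.\<close>
  have neg: "g (- x) = - g x" for x
  proof (rule antisym)
    show "g (- x) \<le> - g x" using sublinear_lower_at[OF g(1), of x] min by blast
    show "- g x \<le> g (- x)" using sublinear_minus[OF g(1), of "- x"] by simp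
  qed
  have "linear g"
  proof (rule linearI)
    fix x z
    have "g x \<le> g (x + z) - g z"
      using sublinear_add[OF g(1), of "x + z" "- z"] neg[of z] by simp
    then show "g (x + z) = g x + g z" using sublinear_add[OF g(1), of x z] by linarith
  next
    fix c x
    show "g (c *\<^sub>R x) = c *\<^sub>R g x"
      using sublinear_scale[OF g(1), of c x] sublinear_scale[OF g(1), of "- c" x] neg[of "c *\<^sub>R x"]
      by (cases "0 \<le> c") auto
  qed
  moreover have gp: "g \<le> p" using g(2) r(2) by simp
  moreover have "g y = p y"
  proof (rule antisym)
    show "g y \<le> p y" using gp by (simp add: le_fun_def)
    have "g (- y) \<le> r (- y)" using g(2) by (simp add: le_fun_def)
    then show "p y \<le> g y" using r(3) neg[of y] by linarith
  qed
  ultimately show ?thesis by blast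
qed

section \<open>Distance to a subspace and separation by real functionals\<close>

lemma sublinear_infdist:
  assumes E: "subspace E"
  shows "sublinear (\<lambda>x::'a::real_normed_vector. infdist x E)"
proof -
  have ne: "E \<noteq> {}" using subspace_0[OF E] by blast
  have add: "infdist (x + y) E \<le> infdist x E + infdist y E" for x y
  proof -
    have "infdist (x + y) E \<le> dist x a + dist y b" if "a \<in> E" "b \<in> E" for a b
      using infdist_le[OF subspace_add[OF E that], of "x + y"] dist_triangle_add[of x y a b] by linarith
    then have "infdist (x + y) E - dist y b \<le> infdist x E" if "b \<in> E" for b
      unfolding infdist_notempty[OF ne, of x]
      by (intro cINF_greatest ne) (use that in \<open>auto simp: algebra_simps\<close>)
    then have "infdist (x + y) E - infdist x E \<le> infdist y E"
      unfolding infdist_notempty[OF ne, of y] by (intro cINF_greatest ne) (auto simp: algebra_simps)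
    then show ?thesis by simp
  qed
  have scale: "infdist (c *\<^sub>R x) E \<le> c * infdist x E" if "0 \<le> c" for c x
  proof (cases "c = 0")
    case True
    then show ?thesis using subspace_0[OF E] by simp
  next
    case False
    have "infdist (c *\<^sub>R x) E / c \<le> infdist x E"
      unfolding infdist_notempty[OF ne, of x]
    proof (intro cINF_greatest ne)
      fix a assume "a \<in> E"
      then have "infdist (c *\<^sub>R x) E \<le> dist (c *\<^sub>R x) (c *\<^sub>R a)"
        by (intro infdist_le subspace_scale[OF E])
      also have "\<dots> = c * dist x a"
        using that by (simp add: dist_norm flip: scaleR_diff_right)
      finally show "infdist (c *\<^sub>R x) E / c \<le> dist x a"
        using that False by (simp add: field_simps)
    qed
    then show ?thesis using that False by (simp add: field_simps)
  qed
  show ?thesis using add scale by (simp add: sublinear_def)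
qed

lemma infdist_le_norm:
  "subspace E \<Longrightarrow> infdist x E \<le> norm (x::'a::real_normed_vector)"
  using infdist_le[of 0 E x] subspace_0[of E] by simp

text \<open>Meant for negation and for multiplication by the imaginary unit, which are isometries
  preserving the subspace.\<close>

lemma infdist_linear_image_le:
  fixes E :: "'a::real_normed_vector set"
  assumes "subspace E" and "\<And>a. a \<in> E \<Longrightarrow> h a \<in> E" and "\<And>x a. dist (h x) (h a) = dist x a"
  shows "infdist (h x) E \<le> infdist x E"
proof -
  have ne: "E \<noteq> {}" using subspace_0[OF assms(1)] by blast
  show ?thesis
    unfolding infdist_notempty[OF ne, of x]
    by (intro cINF_greatest ne) (use assms(2,3) infdist_le in metis)
qed

text \<open>With the distance to \<open>E\<close> as sublinear majorant, Hahn--Banach yields a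
  functional that vanishes on \<open>E\<close>, has norm at most one and attains the distance at
  \<open>y\<close>.\<close>

lemma real_separation:
  fixes E :: "'a::real_normed_vector set"
  assumes E: "subspace E"
  obtains g where "bounded_linear g" "\<And>x. \<bar>g x\<bar> \<le> infdist x E" "g y = infdist y E"
proof -
  obtain g where g: "linear g" "g \<le> (\<lambda>x. infdist x E)" "g y = infdist y E"
    using Hahn_Banach_sublinear[OF sublinear_infdist[OF E]] by blast
  have abs: "\<bar>g x\<bar> \<le> infdist x E" for x
  proof -
    have "infdist (- x) E \<le> infdist x E"
      using infdist_linear_image_le[OF E, of uminus x] subspace_neg[OF E]
      by (simp add: dist_minus)
    moreover have "g x \<le> infdist x E" "g (- x) \<le> infdist (- x) E"
      using g(2) by (auto simp: le_fun_def)
    ultimately show ?thesis using linear_neg[OF g(1), of x] by linarith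
  qed
  have "bounded_linear g"
    unfolding bounded_linear_def bounded_linear_axioms_def
  proof (intro conjI g(1) exI allI)
    fix x show "norm (g x) \<le> norm x * 1"
      using abs[of x] infdist_le_norm[OF E, of x] by simp
  qed
  then show thesis using that abs g(3) by blast
qed

section \<open>Bounded biorthogonal sequences\<close>

context normed_space_over
begin

definition functional :: "('a \<Rightarrow> 'k) \<Rightarrow> bool" where
  "functional F \<longleftrightarrow> bounded_linear F \<and> (\<forall>c x. F (sc c x) = c * F x)"

text \<open>Independence is always carried by coordinate functionals. Both sequences are total
  functions of which only the first \<open>n\<close> entries matter, so a system grows by function
  update.\<close>

definition biorth :: "nat \<Rightarrow> (nat \<Rightarrow> 'a) \<Rightarrow> (nat \<Rightarrow> 'a \<Rightarrow> 'k) \<Rightarrow> bool" where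
  "biorth n v f \<longleftrightarrow> (\<forall>i<n. functional (f i)) \<and>
     (\<forall>i<n. \<forall>j<n. f i (v j) = (if i = j then 1 else 0))"

lemma functional_bounded_linear: "functional F \<Longrightarrow> bounded_linear F"
  and functional_scale: "functional F \<Longrightarrow> F (sc c x) = c * F x"
  by (auto simp: functional_def)

lemma functional_add: "functional F \<Longrightarrow> F (x + y) = F x + F y"
  and functional_diff: "functional F \<Longrightarrow> F (x - y) = F x - F y"
  and functional_zero: "functional F \<Longrightarrow> F 0 = 0"
  and functional_sum: "functional F \<Longrightarrow> F (sum h S) = (\<Sum>i\<in>S. F (h i))"
  and functional_scaleR: "functional F \<Longrightarrow> F (r *\<^sub>R x) = r *\<^sub>R F x"
  by (auto simp: functional_def bounded_linear.axioms(1) linear_add linear_diff linear_0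
      linear_sum linear_scale)

lemma functional_cmult: "functional F \<Longrightarrow> functional (\<lambda>x. c * F x)"
  unfolding functional_def by (auto intro: bounded_linear_compose[OF bounded_linear_mult_right])

lemma functional_sub: "functional F \<Longrightarrow> functional G \<Longrightarrow> functional (\<lambda>x. F x - G x)"
  unfolding functional_def by (auto intro: bounded_linear_sub simp: algebra_simps)

lemma bounded_bilinear_sc: "bounded_bilinear sc"
proof
  show "sc (r *\<^sub>R a) b = r *\<^sub>R sc a b" for r a b
    by (metis mult_scaleR_left mult_1 of_real_def scale_of_real scale_scale)
  show "sc a (r *\<^sub>R b) = r *\<^sub>R sc a b" for r a b
    by (metis scale_of_real scale_left_commute)
  show "\<exists>K. \<forall>a b. norm (sc a b) \<le> norm a * norm b * K"
    by (intro exI[of _ 1]) (simp add: norm_scale)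
qed (auto simp: scale_left_distrib scale_right_distrib)

lemmas bounded_linear_sc_left = bounded_bilinear.bounded_linear_left[OF bounded_bilinear_sc]
lemmas bounded_linear_sc_right = bounded_bilinear.bounded_linear_right[OF bounded_bilinear_sc]

lemma real_subspace: "subspace E \<Longrightarrow> Real_Vector_Spaces.subspace E"
  by (auto simp: subspace_def Real_Vector_Spaces.subspace_def simp flip: scale_of_real)

lemma subspace_functional_ker: "(\<And>g. g \<in> G \<Longrightarrow> functional g) \<Longrightarrow> subspace {x. \<forall>g\<in>G. g x = 0}"
  by (auto simp: subspace_def functional_add functional_zero functional_scale)

text \<open>The vectors equal to their own coordinate expansion form a subspace containing every
  \<open>v i\<close>. This description of the span yields its closedness and the compactness of its
  unit sphere.\<close>

lemma biorth_span_iff: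
  assumes "biorth n v f"
  shows "x \<in> span (v ` {..<n}) \<longleftrightarrow> x = (\<Sum>i<n. sc (f i x) (v i))"
proof
  let ?E = "{x. x = (\<Sum>i<n. sc (f i x) (v i))}"
  assume "x \<in> span (v ` {..<n})"
  moreover have "span (v ` {..<n}) \<subseteq> ?E"
  proof (rule span_minimal)
    have "v j = (\<Sum>i<n. sc (f i (v j)) (v i))" if "j < n" for j
    proof -
      have "(\<Sum>i<n. sc (f i (v j)) (v i)) = (\<Sum>i<n. if i = j then v j else 0)"
        using assms that by (intro sum.cong) (auto simp: biorth_def)
      then show ?thesis using that by simp
    qed
    then show "v ` {..<n} \<subseteq> ?E" by blast
    have F: "functional (f i)" if "i < n" for i using assms that by (simp add: biorth_def)
    show "subspace ?E"
      unfolding subspace_def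
    proof (safe)
      show "0 = (\<Sum>i<n. sc (f i 0) (v i))" using F by (simp add: functional_zero)
    next
      fix x y assume "x = (\<Sum>i<n. sc (f i x) (v i))" "y = (\<Sum>i<n. sc (f i y) (v i))"
      then have "x + y = (\<Sum>i<n. sc (f i x) (v i)) + (\<Sum>i<n. sc (f i y) (v i))" by simp
      also have "\<dots> = (\<Sum>i<n. sc (f i (x + y)) (v i))"
        by (simp add: F functional_add scale_left_distrib sum.distrib)
      finally show "x + y = \<dots>" .
    next
      fix c x assume "x = (\<Sum>i<n. sc (f i x) (v i))"
      then have "sc c x = sc c (\<Sum>i<n. sc (f i x) (v i))" by simp
      also have "\<dots> = (\<Sum>i<n. sc (f i (sc c x)) (v i))"
        by (simp add: F functional_scale scale_sum_right)
      finally show "sc c x = \<dots>" .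
    qed
  qed
  ultimately show "x = (\<Sum>i<n. sc (f i x) (v i))" by blast
next
  assume "x = (\<Sum>i<n. sc (f i x) (v i))"
  also have "\<dots> \<in> span (v ` {..<n})"
    by (intro span_sum span_scale span_base) auto
  finally show "x \<in> span (v ` {..<n})" .
qed

lemma continuous_on_functional: "functional F \<Longrightarrow> continuous_on S F"
  by (simp add: functional_bounded_linear linear_continuous_on)

lemma closed_biorth_span:
  assumes "biorth n v f"
  shows "closed (span (v ` {..<n}))"
proof -
  have "span (v ` {..<n}) = {x. x = (\<Sum>i<n. sc (f i x) (v i))}"
    using biorth_span_iff[OF assms] by blast
  also have "closed \<dots>"
  proof (intro closed_Collect_eq continuous_on_id continuous_on_sum)
    fix i assume "i \<in> {..<n}"
    then have "functional (f i)" using assms by (simp add: biorth_def)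
    then show "continuous_on UNIV (\<lambda>x. sc (f i x) (v i))"
      by (intro bounded_linear.continuous_on[OF bounded_linear_sc_left] continuous_on_functional)
  qed
  finally show ?thesis .
qed

text \<open>Each further functional lowers the dimension by at most one: a finite spanning set of
  the smaller kernel, together with one vector on which \<open>g\<close> does not vanish, spans the
  larger one.\<close>

lemma infinite_dim_functional_ker:
  assumes inf: "infinite_dim sc UNIV" and "finite G" and "\<And>g. g \<in> G \<Longrightarrow> functional g"
  shows "infinite_dim sc {x. \<forall>g\<in>G. g x = 0}"
  using assms(2,3)
proof (induction G)
  case empty
  then show ?case using inf by simp
next
  case (insert g G)
  let ?S = "{x. \<forall>g\<in>G. g x = 0}" and ?S' = "{x. \<forall>g\<in>insert g G. g x = 0}"
  have S: "subspace ?S" "subspace ?S'" by (rule subspace_functional_ker, use insert.prems in blast)+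
  have "\<not> infinite_dim sc ?S" if "\<not> infinite_dim sc ?S'"
  proof (cases "?S \<subseteq> {x. g x = 0}")
    case True
    then have "?S' = ?S" by auto
    then show ?thesis using that by simp
  next
    case False
    then obtain s where s: "s \<in> ?S" "g s \<noteq> 0" by blast
    have "\<exists>B. finite B \<and> span B = ?S'"
      using that unfolding infinite_dim_def by (rule notnotD)
    then obtain B where B: "finite B" "span B = ?S'" by (elim exE conjE)
    have "span (Set.insert s B) = ?S"
    proof
      show "span (Set.insert s B) \<subseteq> ?S"
        using s B span_superset[of B] by (intro span_minimal S) auto
      show "?S \<subseteq> span (Set.insert s B)"
      proof
        fix x assume x: "x \<in> ?S"
        have "x - sc (g x / g s) s \<in> ?S"
          using x s(1) S(1) by (intro subspace_diff subspace_scale) auto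
        moreover have "g (x - sc (g x / g s) s) = 0"
          using s(2) insert.prems by (simp add: functional_diff functional_scale)
        ultimately have "x - sc (g x / g s) s \<in> span B" using B(2) by auto
        then show "x \<in> span (Set.insert s B)" unfolding span_breakdown_eq by blast
      qed
    qed
    then show ?thesis using B(1) unfolding infinite_dim_def by blast
  qed
  then show ?case using insert by blast
qed

lemma exists_nonzero_functional_ker:
  assumes "infinite_dim sc UNIV" and "finite G" and "\<And>g. g \<in> G \<Longrightarrow> functional g"
  obtains a where "a \<noteq> 0" "\<And>g. g \<in> G \<Longrightarrow> g a = 0"
proof -
  have "{x. \<forall>g\<in>G. g x = 0} \<noteq> span {}"
    using infinite_dim_functional_ker[OF assms] unfolding infinite_dim_def by blast
  moreover have "0 \<in> {x. \<forall>g\<in>G. g x = 0}" using assms(3) by (simp add: functional_zero)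
  ultimately show thesis using that by auto
qed

text \<open>If \<open>z\<close> lies in the span, adding a small multiple of a vector outside the
  span leaves it.\<close>

lemma exists_near_not_in_span:
  assumes "infinite_dim sc UNIV" and "finite B" and "\<delta> > 0"
  obtains y where "y \<notin> span B" "norm (y - z) < \<delta>"
proof (cases "z \<in> span B")
  case False
  then show thesis using that[of z] assms(3) by simp
next
  case True
  obtain u where u: "u \<notin> span B" using assms(1,2) unfolding infinite_dim_def by blast
  then have u0: "norm u > 0" using span_zero by auto
  define r where "r = \<delta> / (2 * norm u)"
  have r: "r > 0" using u0 assms(3) by (simp add: r_def)
  show thesis
  proof (rule that)
    show "z + sc (of_real r) u \<notin> span B"
    proof
      assume "z + sc (of_real r) u \<in> span B"
      then have "sc (of_real r) u \<in> span B" using span_diff[OF _ True] by force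
      then have "sc (inverse (of_real r)) (sc (of_real r) u) \<in> span B" by (rule span_scale)
      then show False using u r by simp
    qed
    show "norm (z + sc (of_real r) u - z) < \<delta>"
      using r u0 assms(3) by (simp add: norm_scale) (simp add: r_def)
  qed
qed

end

section \<open>Extending finite biorthogonal systems\<close>

text \<open>This isolates the form of Hahn--Banach used over both fields. The factor 2 leaves room
  for complexifying a real functional by the triangle inequality; \<open>heine_borel\<close> makes
  closed balls of scalars compact.\<close>

locale separated_space = normed_space_over sc
  for sc :: "'k::{real_normed_field,heine_borel} \<Rightarrow> 'a::banach \<Rightarrow> 'a" +
  assumes separation: "\<And>E y. subspace E \<Longrightarrow> \<exists>F. functional F \<and>
    (\<forall>x. norm (F x) \<le> 2 * infdist x E) \<and> infdist y E \<le> norm (F y)"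
begin

lemma separation_normalized:
  assumes E: "subspace E" and d: "infdist y E > 0"
  obtains g where "functional g" "\<And>x. norm (g x) \<le> 2 / infdist y E * norm x"
    "\<And>x. x \<in> E \<Longrightarrow> g x = 0" "g y = 1"
proof -
  obtain F where F: "functional F" "\<And>x. norm (F x) \<le> 2 * infdist x E" "infdist y E \<le> norm (F y)"
    using separation[OF E, of y] by blast
  have Fy: "F y \<noteq> 0" using F(3) d by auto
  show thesis
  proof (rule that)
    show "functional (\<lambda>x. inverse (F y) * F x)" by (intro functional_cmult F)
    show "inverse (F y) * F y = 1" using Fy by simp
    show "inverse (F y) * F x = 0" if "x \<in> E" for x using F(2)[of x] that by simp
    show "norm (inverse (F y) * F x) \<le> 2 / infdist y E * norm x" for x
    proof -
      have "norm (F x) \<le> 2 * norm x"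
        using F(2)[of x] infdist_le_norm[OF real_subspace[OF E], of x] by linarith
      then have "norm (F x) / norm (F y) \<le> (2 * norm x) / infdist y E"
        using F(3) d by (intro frac_le) auto
      then show ?thesis by (simp add: norm_mult norm_inverse divide_inverse mult_ac)
    qed
  qed
qed

text \<open>The span is closed, so some functional \<open>g\<close> kills it and takes the value 1
  at \<open>u\<close>. Subtracting \<open>f i u * g\<close> makes the old functionals vanish at
  \<open>u\<close> and leaves their values on the old vectors unchanged.\<close>

lemma biorth_extend:
  assumes b: "biorth n v f" and u: "u \<notin> span (v ` {..<n})"
  obtains f' where "biorth (Suc n) (v(n := u)) f'"
proof -
  let ?E = "span (v ` {..<n})"
  have "infdist u ?E > 0"
    using infdist_pos_not_in_closed[OF closed_biorth_span[OF b] _ u] span_zero by blast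
  then obtain g where g: "functional g" "\<And>x. x \<in> ?E \<Longrightarrow> g x = 0" "g u = 1"
    using separation_normalized[OF subspace_span] by metis
  have "g (v i) = 0" if "i < n" for i using that by (intro g(2) span_base) auto
  then have "biorth (Suc n) (v(n := u)) (\<lambda>i x. if i < n then f i x - f i u * g x else g x)"
    using b g(1,3) unfolding biorth_def
    by (auto simp: less_Suc_eq intro!: functional_sub functional_cmult)
  then show thesis by (rule that)
qed

lemma exists_biorth_spanning:
  assumes "finite S"
  obtains n v f where "biorth n v f" "S \<subseteq> span (v ` {..<n})"
proof -
  have "\<exists>n v f. biorth n v f \<and> S \<subseteq> span (v ` {..<n})"
    using assms
  proof (induction S)
    case empty
    have "biorth 0 v f" for v f by (simp add: biorth_def)
    then show ?case by blast
  next
    case (insert u S)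
    then obtain n v f where b: "biorth n v f" and S: "S \<subseteq> span (v ` {..<n})" by blast
    show ?case
    proof (cases "u \<in> span (v ` {..<n})")
      case True
      then show ?thesis using b S by blast
    next
      case False
      obtain f' where b': "biorth (Suc n) (v(n := u)) f'" using biorth_extend[OF b False] .
      have im: "(v(n := u)) ` {..<Suc n} = Set.insert u (v ` {..<n})"
        by (auto simp: lessThan_Suc)
      have "Set.insert u S \<subseteq> span ((v(n := u)) ` {..<Suc n})"
        unfolding im using S span_mono[of "v ` {..<n}" "Set.insert u (v ` {..<n})"]
        by (auto intro: span_base)
      then show ?thesis using b' by blast
    qed
  qed
  then show thesis using that by blast
qed

text \<open>The targets \<open>z j\<close> will be the images of the first vectors under a given
  operator. They may be dependent, so each is moved slightly out of the span reached so far.\<close>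

lemma exists_biorth_near:
  assumes inf: "infinite_dim sc UNIV" and b: "biorth n v f" and "\<delta> > 0"
  shows "\<exists>v' f'. biorth (n + k) v' f' \<and> (\<forall>i<n. v' i = v i) \<and> (\<forall>j<k. norm (v' (n + j) - z j) < \<delta>)"
proof (induction k)
  case 0
  then show ?case using b by auto
next
  case (Suc k)
  then obtain v' f' where b': "biorth (n + k) v' f'" and v': "\<forall>i<n. v' i = v i"
    "\<forall>j<k. norm (v' (n + j) - z j) < \<delta>" by blast
  obtain y where y: "y \<notin> span (v' ` {..<n + k})" "norm (y - z k) < \<delta>"
    using exists_near_not_in_span[OF inf _ \<open>\<delta> > 0\<close>, of "v' ` {..<n + k}" "z k"] by auto
  obtain f'' where "biorth (Suc (n + k)) (v'(n + k := y)) f''" using biorth_extend[OF b' y(1)] .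
  moreover have "\<forall>i<n. (v'(n + k := y)) i = v i"
    "\<forall>j<Suc k. norm ((v'(n + k := y)) (n + j) - z j) < \<delta>"
    using v' y(2) by (auto simp: less_Suc_eq)
  ultimately show ?case by (metis add_Suc_right)
qed

section \<open>Compact unit spheres of finite-dimensional spans and Mazur's construction\<close>

lemma compact_bounded_combinations:
  fixes v :: "nat \<Rightarrow> 'a" and n :: nat
  shows "compact {x. \<exists>c. (\<forall>i<n. norm (c i) \<le> M) \<and> x = (\<Sum>i<n. sc (c i) (v i))}"
proof (induction n)
  case 0
  then show ?case by simp
next
  case (Suc n)
  let ?K = "\<lambda>n. {x. \<exists>c. (\<forall>i<n. norm (c i) \<le> M) \<and> x = (\<Sum>i<n. sc (c i) (v i))}"
  let ?L = "(\<lambda>c. sc c (v n)) ` cball 0 M"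
  have "compact ?L"
    by (intro compact_continuous_image compact_cball linear_continuous_on bounded_linear_sc_left)
  then have "compact {x + y | x y. x \<in> ?K n \<and> y \<in> ?L}" by (intro compact_sums Suc.IH)
  moreover have "?K (Suc n) = {x + y | x y. x \<in> ?K n \<and> y \<in> ?L}"
  proof (intro equalityI subsetI)
    fix x assume "x \<in> ?K (Suc n)"
    then obtain c where c: "\<forall>i<Suc n. norm (c i) \<le> M" and x: "x = (\<Sum>i<Suc n. sc (c i) (v i))"
      by blast
    have "(\<Sum>i<n. sc (c i) (v i)) \<in> ?K n"
      using c by (intro CollectI exI[of _ c]) simp
    moreover have "sc (c n) (v n) \<in> ?L" using c by auto
    ultimately show "x \<in> {x + y | x y. x \<in> ?K n \<and> y \<in> ?L}" unfolding x sum.lessThan_Suc by blast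
  next
    fix z assume "z \<in> {x + y | x y. x \<in> ?K n \<and> y \<in> ?L}"
    then obtain c d where "\<forall>i<n. norm (c i) \<le> M" "norm d \<le> M"
      and "z = (\<Sum>i<n. sc (c i) (v i)) + sc d (v n)" by auto
    then show "z \<in> ?K (Suc n)"
      by (auto intro!: exI[of _ "c(n := d)"] simp: less_Suc_eq)
  qed
  ultimately show ?case by simp
qed

lemma closed_sphere_normed: "closed (sphere (x::'a) r)"
  using closed_Collect_eq[of "dist x" "\<lambda>_. r"] by (simp add: sphere_def continuous_intros)

text \<open>Coordinates are bounded on the unit sphere, so the sphere is a closed part of the
  compact set of combinations with bounded coefficients.\<close>

lemma compact_biorth_sphere:
  assumes b: "biorth n v f"
  shows "compact (span (v ` {..<n}) \<inter> sphere 0 1)"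
proof -
  have "\<exists>M. \<forall>i<n. \<forall>x. norm (f i x) \<le> M * norm x"
  proof -
    have "norm (f i x) \<le> (\<Sum>j<n. onorm (f j)) * norm x" if "i < n" for i x
    proof -
      have bl: "bounded_linear (f j)" if "j < n" for j
        using b that by (simp add: biorth_def functional_bounded_linear)
      have "onorm (f i) \<le> (\<Sum>j<n. onorm (f j))"
        using that bl by (intro member_le_sum) (auto intro: onorm_pos_le)
      then show ?thesis
        using onorm[OF bl[OF that], of x] mult_right_mono[OF _ norm_ge_zero[of x]] by (meson order_trans)
    qed
    then show ?thesis by blast
  qed
  then obtain M where M: "\<And>i x. i < n \<Longrightarrow> norm (f i x) \<le> M * norm x" by blast
  let ?K = "{x. \<exists>c. (\<forall>i<n. norm (c i) \<le> M) \<and> x = (\<Sum>i<n. sc (c i) (v i))}"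
  have "span (v ` {..<n}) \<inter> sphere 0 1 \<subseteq> ?K"
  proof
    fix x assume "x \<in> span (v ` {..<n}) \<inter> sphere 0 1"
    then have "x = (\<Sum>i<n. sc (f i x) (v i))" "norm x = 1"
      using biorth_span_iff[OF b, of x] by auto
    then show "x \<in> ?K" using M[of _ x] by (auto intro!: exI[of _ "\<lambda>i. f i x"])
  qed
  then have "span (v ` {..<n}) \<inter> sphere 0 1 = ?K \<inter> (span (v ` {..<n}) \<inter> sphere 0 1)" by blast
  also have "compact \<dots>"
    by (intro compact_Int_closed compact_bounded_combinations closed_Int closed_biorth_span[OF b]
        closed_sphere_normed)
  finally show ?thesis .
qed

text \<open>Mazur's construction of basic sequences: finitely many functionals almost norm the
  finite-dimensional span, so their common kernel stays away from it.\<close>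

lemma biorth_norming_functionals:
  assumes b: "biorth n v f"
  obtains G where "finite G" "\<And>g. g \<in> G \<Longrightarrow> functional g"
    "\<And>a e. (\<And>g. g \<in> G \<Longrightarrow> g a = 0) \<Longrightarrow> e \<in> span (v ` {..<n}) \<Longrightarrow> norm a \<le> 5 * norm (a + e)"
proof -
  let ?E = "span (v ` {..<n})"
  let ?S = "?E \<inter> sphere 0 1"
  have "\<exists>F. functional F \<and> (\<forall>x. norm (F x) \<le> 2 * norm x) \<and> norm e \<le> norm (F e)" for e
    using separation[of "{0}" e] by simp
  then obtain F where F: "\<And>e. functional (F e)" "\<And>e x. norm (F e x) \<le> 2 * norm x"
    "\<And>e. norm e \<le> norm (F e e)" by metis
  \<comment> \<open>On the unit sphere the value of \<open>F e\<close> at \<open>e\<close> has norm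
    at least 1, so these open sets cover the sphere.\<close>
  have op: "open {x. norm (F e x) > 1 / 2}" for e
    by (intro open_Collect_less continuous_on_norm continuous_on_functional F continuous_on_const)
  have "?S \<subseteq> (\<Union>e\<in>?S. {x. norm (F e x) > 1 / 2})"
  proof
    fix e assume e: "e \<in> ?S"
    then have "norm (F e e) > 1 / 2" using F(3)[of e] by auto
    then show "e \<in> (\<Union>e\<in>?S. {x. norm (F e x) > 1 / 2})" using e by blast
  qed
  then obtain S where S: "S \<subseteq> ?S" "finite S" "?S \<subseteq> (\<Union>e\<in>S. {x. norm (F e x) > 1 / 2})"
    using compactE_image[OF compact_biorth_sphere[OF b], of ?S "\<lambda>e. {x. norm (F e x) > 1 / 2}"] op
    by metis
  show thesis
  proof (rule that)
    show "finite (F ` S)" using S(2) by simp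
    show "functional g" if "g \<in> F ` S" for g using that F(1) by blast
    fix a e assume a: "\<And>g. g \<in> F ` S \<Longrightarrow> g a = 0" and e: "e \<in> ?E"
    \<comment> \<open>Some selected functional exceeds half the norm of \<open>e\<close> at
      \<open>e\<close>, does not see \<open>a\<close> and has norm at most 2; this gives the factor
      4, and the triangle inequality then gives 5.\<close>
    have "norm e \<le> 4 * norm (a + e)"
    proof (cases "e = 0")
      case False
      define r where "r = inverse (norm e)"
      have r: "r > 0" using False by (simp add: r_def)
      have "r *\<^sub>R e \<in> ?S" using False span_scale[OF e, of "of_real r"] by (simp add: r_def scale_of_real del: of_real_inverse)
      then obtain e' where e': "e' \<in> S" "norm (F e' (r *\<^sub>R e)) > 1 / 2" using S(3) by blast
      have "F e' (r *\<^sub>R (a + e)) = F e' (r *\<^sub>R e)"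
        using a[of "F e'"] e'(1) by (simp add: functional_scaleR functional_add F(1))
      then have "1 / 2 < 2 * norm (r *\<^sub>R (a + e))" using e'(2) F(2)[of e' "r *\<^sub>R (a + e)"] by simp
      then have "1 / 2 < 2 * (r * norm (a + e))" using r by simp
      then show ?thesis using False by (simp add: r_def divide_simps split: if_splits)
    qed simp
    then show "norm a \<le> 5 * norm (a + e)" using norm_triangle_ineq4[of "a + e" e] by simp
  qed
qed

text \<open>The vector \<open>a\<close> is killed by the norming functionals and by every
  \<open>f i\<close>. The former keep it at distance 1 / 5 from the span, whence the bound 2 / (1 /
  5) = 10. The latter spare any correction of the old functionals, so their bounds do not
  deteriorate.\<close>

lemma biorth_bounded_step:
  assumes inf: "infinite_dim sc UNIV" and b: "biorth n v f"
  obtains a g where "norm a = 1" "functional g" "\<And>x. norm (g x) \<le> 10 * norm x"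
    "\<And>i. i < n \<Longrightarrow> g (v i) = 0" "\<And>i. i < n \<Longrightarrow> f i a = 0" "g a = 1"
proof -
  let ?E = "span (v ` {..<n})"
  obtain G where G: "finite G" "\<And>g. g \<in> G \<Longrightarrow> functional g"
    "\<And>a e. (\<And>g. g \<in> G \<Longrightarrow> g a = 0) \<Longrightarrow> e \<in> ?E \<Longrightarrow> norm a \<le> 5 * norm (a + e)"
    using biorth_norming_functionals[OF b] by blast
  have fnl: "functional g" if "g \<in> G \<union> f ` {..<n}" for g
    using that G(2) b by (auto simp: biorth_def)
  have "finite (G \<union> f ` {..<n})" using G(1) by simp
  from exists_nonzero_functional_ker[OF inf this fnl]
  obtain u where u: "u \<noteq> 0" "\<And>g. g \<in> G \<union> f ` {..<n} \<Longrightarrow> g u = 0"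
    by blast
  define a where "a = inverse (norm u) *\<^sub>R u"
  have a: "norm a = 1" "\<And>g. g \<in> G \<union> f ` {..<n} \<Longrightarrow> g a = 0"
    using u by (auto simp: a_def functional_scaleR[OF fnl])
  have "1 / 5 \<le> dist a e" if "e \<in> ?E" for e
    using G(3)[of a "- e"] a that span_neg[OF that] by (simp add: dist_norm)
  then have "1 / 5 \<le> infdist a ?E"
    using span_zero by (subst infdist_notempty) (blast intro: cINF_greatest)+
  then obtain g where g: "functional g" "\<And>x. norm (g x) \<le> 2 / infdist a ?E * norm x"
    "\<And>x. x \<in> ?E \<Longrightarrow> g x = 0" "g a = 1"
    using separation_normalized[OF subspace_span, of a "v ` {..<n}"] by auto
  have "2 / infdist a ?E \<le> 2 / (1 / 5)" using \<open>1 / 5 \<le> infdist a ?E\<close> by (intro divide_left_mono) auto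
  then have "2 / infdist a ?E * norm x \<le> 10 * norm x" for x
    by (intro mult_right_mono) auto
  then have "norm (g x) \<le> 10 * norm x" for x
    using g(2) order_trans by blast
  then show thesis using that[of a g] a g by (simp add: span_base)
qed

lemma exists_bounded_biorth_sequence:
  assumes inf: "infinite_dim sc UNIV" and b: "biorth p v f"
  obtains v' f' C where "\<And>i. i < p \<Longrightarrow> v' i = v i" "\<And>n. biorth n v' f'" "C > 0"
    "\<And>n. norm (v' n) \<le> C" "\<And>n x. norm (f' n x) \<le> C * norm x"
proof -
  \<comment> \<open>The first \<open>p\<close> entries are prescribed. Afterwards the condition is
    an implication, so that a choice exists for every history; biorthogonality of the actual history
    is recovered by induction in \<open>bn\<close>.\<close>
  define P where "P h n r \<longleftrightarrow> (if n < p then r = (v n, f n) else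
    biorth n (fst \<circ> h) (snd \<circ> h) \<longrightarrow> norm (fst r) = 1 \<and> functional (snd r) \<and>
      (\<forall>x. norm (snd r x) \<le> 10 * norm x) \<and>
      (\<forall>i<n. snd r (fst (h i)) = 0 \<and> snd (h i) (fst r) = 0) \<and> snd r (fst r) = 1)"
    for h :: "nat \<Rightarrow> 'a \<times> ('a \<Rightarrow> 'k)" and n r
  have "\<exists>h. \<forall>n. P h n (h n)"
  proof (rule dependent_wf_choice[of less_than])
    show "wf less_than" by simp
    fix h h' :: "nat \<Rightarrow> 'a \<times> ('a \<Rightarrow> 'k)" and n r
    assume "\<And>z. (z, n) \<in> less_than \<Longrightarrow> h z = h' z"
    then have "\<And>z. z < n \<Longrightarrow> h z = h' z" by simp
    then show "P h n r = P h' n r" by (simp add: P_def biorth_def)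
  next
    fix n and h :: "nat \<Rightarrow> 'a \<times> ('a \<Rightarrow> 'k)"
    show "\<exists>r. P h n r"
    proof (cases "\<not> n < p \<and> biorth n (fst \<circ> h) (snd \<circ> h)")
      case True
      then have bn: "biorth n (fst \<circ> h) (snd \<circ> h)" ..
      obtain a g where "norm a = 1" "functional g" "\<And>x. norm (g x) \<le> 10 * norm x"
        "\<And>i. i < n \<Longrightarrow> g ((fst \<circ> h) i) = 0" "\<And>i. i < n \<Longrightarrow> (snd \<circ> h) i a = 0" "g a = 1"
        using biorth_bounded_step[OF inf bn] by blast
      then have "P h n (a, g)" by (auto simp: P_def split: if_splits) (use True in auto)
      then show ?thesis by blast
    qed (auto simp: P_def)
  qed
  then obtain h where h: "\<And>n. P h n (h n)" by blast
  define v' f' where "v' = fst \<circ> h" and "f' = snd \<circ> h"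
  have init: "v' i = v i" "f' i = f i" if "i < p" for i
    using h[of i] that by (auto simp: P_def v'_def f'_def)
  have step: "norm (v' n) = 1" "functional (f' n)" "norm (f' n x) \<le> 10 * norm x"
    "f' n (v' n) = 1" "\<And>i. i < n \<Longrightarrow> f' n (v' i) = 0 \<and> f' i (v' n) = 0"
    if "n \<ge> p" "biorth n v' f'" for n x
    using h[of n] that by (auto simp: P_def v'_def f'_def)
  have bn: "biorth n v' f'" for n
  proof (induction n)
    case 0
    then show ?case by (simp add: biorth_def)
  next
    case (Suc n)
    show ?case
    proof (cases "n < p")
      case True
      then show ?thesis using b init by (simp add: biorth_def)
    next
      case False
      then show ?thesis using step[OF _ Suc.IH] Suc.IH by (auto simp: biorth_def less_Suc_eq)
    qed
  qed
  have fn: "functional (f' n)" for n using bn[of "Suc n"] by (simp add: biorth_def)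
  \<comment> \<open>Chosen vectors have norm 1 and chosen functionals norm at most 10; the finitely
    many norms of the prescribed entries are added.\<close>
  define C where "C = 10 + (\<Sum>i<p. norm (v' i) + onorm (f' i))"
  have nn: "0 \<le> norm (v' i) + onorm (f' i)" for i
    using onorm_pos_le[OF functional_bounded_linear[OF fn]] by (simp add: add_nonneg_nonneg)
  have C10: "C \<ge> 10" unfolding C_def using nn by (simp add: sum_nonneg)
  have small: "norm (v' i) + onorm (f' i) \<le> C" if "i < p" for i
    using member_le_sum[of i "{..<p}" "\<lambda>i. norm (v' i) + onorm (f' i)"] that nn
    unfolding C_def by auto
  show thesis
  proof (rule that[OF init(1) bn])
    show "C > 0" using C10 by simp
    show "norm (v' n) \<le> C" for n
    proof (cases "n < p")
      case True
      then show ?thesis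
        using small[of n] onorm_pos_le[OF functional_bounded_linear[OF fn[of n]]] by linarith
    next
      case False
      then show ?thesis using step(1)[OF _ bn] C10 by simp
    qed
    show "norm (f' n x) \<le> C * norm x" for n x
    proof (cases "n < p")
      case True
      then have "onorm (f' n) \<le> C" using small[of n] norm_ge_zero[of "v' n"] by linarith
      then show ?thesis
        using onorm[OF functional_bounded_linear[OF fn], of n x] mult_right_mono[OF _ norm_ge_zero[of x]]
        by (meson order_trans)
    next
      case False
      then have "norm (f' n x) \<le> 10 * norm x" using step(3)[OF _ bn] by simp
      also have "\<dots> \<le> C * norm x" using C10 by (intro mult_right_mono) auto
      finally show ?thesis .
    qed
  qed
qed

end

section \<open>Separation over the real and the complex field\<close>

lemma separated_space_real: "separated_space (scaleR :: real \<Rightarrow> 'a::banach \<Rightarrow> 'a)"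
proof -
  note functional_def = normed_space_over.functional_def[OF normed_space_over_scaleR]
  show ?thesis
  proof (intro separated_space.intro separated_space_axioms.intro normed_space_over_scaleR)
    fix E :: "'a set" and y :: 'a
    assume "module.subspace (scaleR :: real \<Rightarrow> 'a \<Rightarrow> 'a) E"
    then have "Real_Vector_Spaces.subspace E" by (simp add: subspace_raw_def)
    then obtain g where "bounded_linear g" "\<And>x. \<bar>g x\<bar> \<le> infdist x E" "g y = infdist y E"
      using real_separation by blast
    moreover have "\<bar>g x\<bar> \<le> 2 * infdist x E" for x
      using calculation(2)[of x] infdist_nonneg[of x E] by linarith
    ultimately show "\<exists>F. normed_space_over.functional ((*\<^sub>R) :: real \<Rightarrow> 'a \<Rightarrow> 'a) F \<and>
        (\<forall>x. norm (F x) \<le> 2 * infdist x E) \<and> infdist y E \<le> norm (F y)"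
      by (intro exI[of _ g]) (auto simp: functional_def linear_simps)
  qed
qed

locale complex_normed_space = normed_space_over sc for sc :: "complex \<Rightarrow> 'a::banach \<Rightarrow> 'a"
begin

lemma separated: "separated_space sc"
proof (intro separated_space.intro separated_space_axioms.intro normed_space_over_axioms)
  fix E and y
  assume E: "subspace E"
  obtain g where g: "bounded_linear g" "\<And>x. \<bar>g x\<bar> \<le> infdist x E" "g y = infdist y E"
    using real_separation[OF real_subspace[OF E]] by blast
  \<comment> \<open>This is the complex functional with real part \<open>g\<close>, namely g x -
    \<i> g (\<i> x). As \<open>E\<close> is invariant under \<i>, the second term is bounded by the
    distance of \<open>x\<close> to \<open>E\<close> as well.\<close>
  define F where "F x = Complex (g x) (- g (sc \<i> x))" for x
  have F: "F x = of_real (g x) - \<i> * of_real (g (sc \<i> x))" for x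
    by (simp add: F_def complex_eq_iff)
  have bl: "bounded_linear F"
    unfolding F
    by (intro bounded_linear_sub bounded_linear_compose[OF bounded_linear_mult_right]
        bounded_linear_compose[OF bounded_linear_of_real] bounded_linear_compose[OF g(1)]
        g(1) bounded_linear_sc_right)
  have g_scale: "g (sc (of_real r) x) = r * g x" for r x
    by (simp add: scale_of_real linear_simps(5)[OF g(1)])
  have "F (sc c x) = c * F x" for c x
  proof -
    have split: "sc (a * \<i> + b) x = sc a (sc \<i> x) + sc b x" for a b
      by (simp add: scale_left_distrib)
    have "of_real (Im c) * \<i> + of_real (Re c) = c"
      by (simp add: complex_eq_iff)
    then have c: "sc c x = sc (of_real (Im c)) (sc \<i> x) + sc (of_real (Re c)) x"
      using split[of "of_real (Im c)" "of_real (Re c)"] by simp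
    have "of_real (Re c) * \<i> + of_real (- Im c) = \<i> * c"
      by (simp add: complex_eq_iff)
    then have ic: "sc \<i> (sc c x) = sc (of_real (Re c)) (sc \<i> x) + sc (of_real (- Im c)) x"
      using split[of "of_real (Re c)" "of_real (- Im c)"] by simp
    show ?thesis
      unfolding F_def ic unfolding c
      by (simp add: g_scale linear_simps(1)[OF g(1)] complex_eq_iff del: of_real_minus scale_scale)
  qed
  moreover have "norm (F x) \<le> 2 * infdist x E" for x
  proof -
    have "infdist (sc \<i> x) E \<le> infdist x E"
      using E by (intro infdist_linear_image_le real_subspace subspace_scale)
        (auto simp: dist_norm norm_scale simp flip: scale_right_diff_distrib)
    then show ?thesis
      using g(2)[of x] g(2)[of "sc \<i> x"] norm_triangle_ineq4[of "of_real (g x)" "\<i> * of_real (g (sc \<i> x))"]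
      by (simp add: F norm_mult)
  qed
  moreover have "infdist y E \<le> norm (F y)"
    using abs_Re_le_cmod[of "F y"] g(3) infdist_nonneg[of y E] by (simp add: F_def)
  ultimately show "\<exists>F. functional F \<and> (\<forall>x. norm (F x) \<le> 2 * infdist x E) \<and> infdist y E \<le> norm (F y)"
    using bl by (intro exI[of _ F]) (simp add: functional_def)
qed

end

section \<open>Periodic blocks with slowly growing drift\<close>

lemma bounded_linear_suminf:
  fixes k :: "nat \<Rightarrow> 'a::real_normed_vector \<Rightarrow> 'b::banach"
  assumes bl: "\<And>n. bounded_linear (k n)" and le: "\<And>n x. norm (k n x) \<le> \<kappa> n * norm x"
    and \<kappa>: "summable \<kappa>"
  shows sums_bounded_linear: "(\<lambda>n. k n x) sums (\<Sum>n. k n x)"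
    and "bounded_linear (\<lambda>x. \<Sum>n. k n x)"
proof -
  have sn: "summable (\<lambda>n. norm (k n x))" for x
    by (rule summable_comparison_test[OF _ summable_mult2[OF \<kappa>, of "norm x"]]) (use le in auto)
  then have sm: "summable (\<lambda>n. k n x)" for x by (rule summable_norm_cancel)
  then show "(\<lambda>n. k n x) sums (\<Sum>n. k n x)" for x by (rule summable_sums)
  show "bounded_linear (\<lambda>x. \<Sum>n. k n x)"
  proof (rule bounded_linear_intro)
    show "(\<Sum>n. k n (x + y)) = (\<Sum>n. k n x) + (\<Sum>n. k n y)" for x y
      by (simp add: suminf_add sm linear_simps(1)[OF bl])
    show "(\<Sum>n. k n (r *\<^sub>R x)) = r *\<^sub>R (\<Sum>n. k n x)" for r x
      by (simp add: suminf_scaleR_right sm linear_simps(5)[OF bl])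
    show "norm (\<Sum>n. k n x) \<le> norm x * (\<Sum>n. \<kappa> n)" for x
    proof -
      have "norm (\<Sum>n. k n x) \<le> (\<Sum>n. norm (k n x))" by (rule summable_norm[OF sn])
      also have "\<dots> \<le> (\<Sum>n. \<kappa> n * norm x)" by (intro suminf_le le sn summable_mult2 \<kappa>)
      also have "\<dots> = norm x * (\<Sum>n. \<kappa> n)" using suminf_mult2[OF \<kappa>, of "norm x"] by (simp add: mult.commute)
      finally show ?thesis .
    qed
  qed
qed

lemma abs_cos_minus_one_le: "\<bar>cos y - 1\<bar> \<le> \<bar>y::real\<bar>"
proof -
  have "\<bar>cos y - 1\<bar> = 2 * (\<bar>sin (y / 2)\<bar> * \<bar>sin (y / 2)\<bar>)"
    using cos_double_sin[of "y / 2"] by (simp add: power2_eq_square abs_mult)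
  also have "\<dots> \<le> 2 * (1 * \<bar>y / 2\<bar>)"
    by (intro mult_left_mono mult_mono abs_sin_x_le_abs_x abs_sin_le_one) auto
  finally show ?thesis by simp
qed

text \<open>Real and imaginary parts of S_(t+1) = 1 + exp (\<i> \<theta>) S_t for the partial
  geometric sums S_t. The real form serves both scalar fields.\<close>

lemma
  fixes \<theta> :: real
  shows cos_sum_rotate: "(\<Sum>i<Suc t. cos (real i * \<theta>)) =
      cos \<theta> * (\<Sum>i<t. cos (real i * \<theta>)) - sin \<theta> * (\<Sum>i<t. sin (real i * \<theta>)) + 1"
    and sin_sum_rotate: "(\<Sum>i<Suc t. sin (real i * \<theta>)) =
      sin \<theta> * (\<Sum>i<t. cos (real i * \<theta>)) + cos \<theta> * (\<Sum>i<t. sin (real i * \<theta>))"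
proof -
  have "(\<Sum>i<Suc t. cos (real i * \<theta>)) =
      1 + (\<Sum>i<t. cos \<theta> * cos (real i * \<theta>) - sin \<theta> * sin (real i * \<theta>))"
    by (simp add: sum.lessThan_Suc_shift cos_add distrib_right del: sum.lessThan_Suc)
  then show "(\<Sum>i<Suc t. cos (real i * \<theta>)) =
      cos \<theta> * (\<Sum>i<t. cos (real i * \<theta>)) - sin \<theta> * (\<Sum>i<t. sin (real i * \<theta>)) + 1"
    by (simp only: sum_subtractf sum_distrib_left)
  have "(\<Sum>i<Suc t. sin (real i * \<theta>)) =
      (\<Sum>i<t. sin \<theta> * cos (real i * \<theta>) + cos \<theta> * sin (real i * \<theta>))"
    by (simp add: sum.lessThan_Suc_shift sin_add distrib_right del: sum.lessThan_Suc)
  then show "(\<Sum>i<Suc t. sin (real i * \<theta>)) =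
      sin \<theta> * (\<Sum>i<t. cos (real i * \<theta>)) + cos \<theta> * (\<Sum>i<t. sin (real i * \<theta>))"
    by (simp only: sum.distrib sum_distrib_left)
qed

text \<open>The linear system has determinant (1 - r)^2 + s^2, which is non-zero.\<close>

lemma rotation_fixed_point_zero:
  fixes x y r s :: real
  assumes "x = r * x - s * y" "y = s * x + r * y" "r \<noteq> 1"
  shows "x = 0" "y = 0"
proof -
  have "((1 - r)\<^sup>2 + s\<^sup>2) * x = 0" "((1 - r)\<^sup>2 + s\<^sup>2) * y = 0"
    using assms(1,2) by algebra+
  moreover have "(1 - r)\<^sup>2 + s\<^sup>2 \<noteq> 0"
    using assms(3) by (simp add: sum_power2_eq_zero_iff)
  ultimately show "x = 0" "y = 0" by auto
qed

text \<open>After whole turns the next summand pair is (1, 0), so the pair of sums is a fixed point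
  of a non-trivial rotation.\<close>

lemma trig_sum_period:
  fixes \<theta> :: real
  assumes "cos (real t * \<theta>) = 1" "sin (real t * \<theta>) = 0" "cos \<theta> \<noteq> 1"
  shows "(\<Sum>i<t. cos (real i * \<theta>)) = 0" and "(\<Sum>i<t. sin (real i * \<theta>)) = 0"
  using rotation_fixed_point_zero[OF _ _ assms(3)] cos_sum_rotate[of \<theta> t] sin_sum_rotate[of \<theta> t] assms(1,2)
  by auto

text \<open>\<open>J\<close> carries the approximation of the given operator and acts trivially on
  the blocks and on all coordinates that govern the dynamics. The vectors \<open>e\<close> and
  \<open>e'\<close> show that the regions where \<open>p\<close> dominates \<open>q\<close> and
  where \<open>q\<close> dominates \<open>p\<close> are non-empty.\<close>

locale periodic_blocks = normed_space_over sc
  for sc :: "'k::real_normed_field \<Rightarrow> 'a::banach \<Rightarrow> 'a" +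
  fixes a b :: "nat \<Rightarrow> 'a" and fa fb :: "nat \<Rightarrow> 'a \<Rightarrow> 'k" and p q :: "'a \<Rightarrow> 'k" and J :: "'a \<Rightarrow> 'a"
    and C :: real and c :: "nat \<Rightarrow> nat" and w :: "nat \<Rightarrow> 'k" and e e' :: 'a
  assumes functionals: "functional (fa n)" "functional (fb n)" "functional p" "functional q"
    and fa_ab: "fa n (a l) = (if n = l then 1 else 0)" "fa n (b l) = 0"
    and fb_ab: "fb n (a l) = 0" "fb n (b l) = (if n = l then 1 else 0)"
    and pq_ab: "p (a n) = 0" "p (b n) = 0" "q (a n) = 0" "q (b n) = 0"
    and pq_e: "p e = 1" "q e = 0" "p e' = 0" "q e' = 1"
    and C_pos: "C > 0"
    and bounds: "norm (a n) \<le> C" "norm (b n) \<le> C" "norm (fa n x) \<le> C * norm x"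
      "norm (fb n x) \<le> C * norm x" "norm (p x) \<le> C * norm x" "norm (q x) \<le> C * norm x"
    and bounded_linear_J: "bounded_linear J" and J_sc: "J (sc r x) = sc r (J x)"
    and J_J: "J (J x) = x" and J_ab: "J (a n) = a n" "J (b n) = b n"
    and J_fix: "fa n (J x) = fa n x" "fb n (J x) = fb n x" "p (J x) = p x" "q (J x) = q x"
    and c_pos: "c n \<ge> 1" and c_at_top: "filterlim c at_top sequentially"
    and w_le: "norm (w n) \<le> 1"
    and w_approx: "norm z \<le> 1 \<Longrightarrow> \<eta> > 0 \<Longrightarrow> \<exists>\<^sub>F n in sequentially. real (c n) * norm (z - w n) < \<eta>"
begin

text \<open>The leading 2 makes every \<open>m n\<close> even, so that \<open>J\<close> drops out at
  these times. The powers of 2 make later rotations and drifts summable, and the factors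
  \<open>c (Suc i)\<close> compensate the weights in the drift. Block \<open>n\<close> has period
  \<open>m (Suc n)\<close> and drift scale \<open>c n\<close> at time \<open>m n\<close>.\<close>

definition m :: "nat \<Rightarrow> nat" where "m n = 2 * (\<Prod>i<n. 2 ^ Suc i * c (Suc i))"
definition \<theta> :: "nat \<Rightarrow> real" where "\<theta> n = 2 * pi / m (Suc n)"
definition \<epsilon> :: "nat \<Rightarrow> real" where "\<epsilon> n = c n / m n"
definition g :: "nat \<Rightarrow> 'a \<Rightarrow> 'k" where "g n x = p x - w n * q x"

lemma m_Suc: "m (Suc n) = m n * (2 ^ Suc n * c (Suc n))"
  by (simp add: m_def)

lemma m_pos: "m n > 0"
proof -
  have "c l > 0" for l using c_pos[of l] by simp
  then show ?thesis by (simp add: m_def prod_pos)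
qed

lemma even_m: "even (m n)" by (simp add: m_def)

lemma m_double_le: "2 * m n \<le> m (Suc n)"
proof -
  have "m n * (2 * 1) \<le> m n * (2 ^ Suc n * c (Suc n))"
    using c_pos[of "Suc n"] by (intro mult_mono le_refl) auto
  then show ?thesis by (simp add: m_Suc)
qed

lemma m_mono: "n \<le> N \<Longrightarrow> m n \<le> m N"
proof (induction rule: dec_induct)
  case (step k)
  then show ?case using m_double_le[of k] by linarith
qed simp

lemma less_m: "n < m n"
proof (induction n)
  case (Suc n)
  then show ?case using m_double_le[of n] by linarith
qed (simp add: m_pos)

lemma m_dvd: "n \<le> N \<Longrightarrow> m n dvd m N"
  by (induction rule: dec_induct) (auto simp: m_Suc)

text \<open>The left side is \<open>\<epsilon> n\<close> times \<open>m N\<close>, the drift scale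
  of a later block at time \<open>m N\<close>. Passing from index n - 1 to n multiplies the period
  by \<open>2 ^ n * c n\<close>, which pays for both the weight and the geometric decay.\<close>

lemma m_ratio_le: "N < n \<Longrightarrow> c n * (m N / m n) \<le> (1 / 2) ^ n"
proof -
  assume "N < n"
  then obtain k where n: "n = Suc k" and k: "N \<le> k" by (cases n) auto
  have "real (c n) * (m N / m n) = (1 / 2) ^ n * (m N / m k)"
    using c_pos[of n] unfolding n m_Suc by (simp add: field_simps)
  also have "\<dots> \<le> (1 / 2) ^ n * 1"
    using m_mono[OF k] m_pos[of k] by (intro mult_left_mono) auto
  finally show ?thesis by simp
qed

text \<open>This bounds the total angle turned until time \<open>m N\<close>. It includes the block
  \<open>N\<close> itself because \<open>\<theta> n\<close> has denominator
  \<open>m (Suc n)\<close>.\<close>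

lemma m_theta_le: "N \<le> n \<Longrightarrow> m N * \<theta> n \<le> pi * (1 / 2) ^ n"
proof -
  assume "N \<le> n"
  then have "real (m N) / m (Suc n) \<le> c (Suc n) * (m N / m (Suc n))"
    using c_pos[of "Suc n"] mult_right_mono[of 1 "real (c (Suc n))" "real (m N) / m (Suc n)"] by simp
  also have "\<dots> \<le> (1 / 2) ^ Suc n" using m_ratio_le[of N "Suc n"] \<open>N \<le> n\<close> by simp
  finally show ?thesis
    using mult_left_mono[of "real (m N) / m (Suc n)" "(1 / 2) ^ Suc n" "2 * pi"]
    by (simp add: \<theta>_def field_simps)
qed

lemma theta_pos: "\<theta> n > 0" by (simp add: \<theta>_def m_pos)

lemma eps_pos: "\<epsilon> n > 0" using c_pos[of n] m_pos[of n] by (simp add: \<epsilon>_def)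

lemma theta_le: "\<theta> n \<le> pi * (1 / 2) ^ n"
proof -
  have "1 * \<theta> n \<le> m 0 * \<theta> n" using theta_pos[of n] by (intro mult_right_mono) (auto simp: m_def)
  then show ?thesis using m_theta_le[of 0 n] by simp
qed

lemma eps_le: "0 < n \<Longrightarrow> \<epsilon> n \<le> (1 / 2) ^ n"
proof -
  assume "0 < n"
  have "\<epsilon> n \<le> c n * (m 0 / m n)"
    using m_pos[of n] by (simp add: \<epsilon>_def m_def[of 0] field_simps)
  then show ?thesis using m_ratio_le[OF \<open>0 < n\<close>] by simp
qed

lemma summable_theta: "summable \<theta>"
  by (rule summable_comparison_test[of _ "\<lambda>n. pi * (1 / 2) ^ n"])
    (use theta_le theta_pos in \<open>auto simp: less_imp_le\<close>)

lemma summable_eps: "summable \<epsilon>"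
  by (rule summable_comparison_test[of _ "\<lambda>n. (1 / 2) ^ n"])
    (use eps_le eps_pos in \<open>auto simp: less_imp_le intro!: exI[of _ 1]\<close>)

section \<open>The drift functional and the perturbation\<close>

lemma functional_g: "functional (g n)"
  unfolding g_def by (intro functional_sub functional_cmult functionals)

lemma norm_g_le: "norm (g n x) \<le> norm (p x) + norm (q x)"
proof -
  have "norm (w n) * norm (q x) \<le> 1 * norm (q x)" using w_le by (intro mult_right_mono) auto
  then show ?thesis
    unfolding g_def using norm_triangle_ineq4[of "p x" "w n * q x"] by (simp add: norm_mult)
qed

text \<open>The bound does not depend on \<open>n\<close>: where \<open>p\<close> dominates
  \<open>q\<close>, no block escapes its drift.\<close>

lemma g_ge: "norm (p x) - norm (q x) \<le> norm (g n x)"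
proof -
  have "norm (w n) * norm (q x) \<le> 1 * norm (q x)" using w_le by (intro mult_right_mono) auto
  then show ?thesis
    unfolding g_def using norm_triangle_ineq2[of "p x" "w n * q x"] by (simp add: norm_mult)
qed

text \<open>\<open>J\<close> already acts as the identity on block coordinates, so \<open>ka\<close>
  and \<open>kb\<close> are the rotation minus the identity, with the drift added in the
  \<open>a\<close> direction.\<close>

definition ka :: "nat \<Rightarrow> 'a \<Rightarrow> 'k" where
  "ka n x = (cos (\<theta> n) - 1) *\<^sub>R fa n x - sin (\<theta> n) *\<^sub>R fb n x + \<epsilon> n *\<^sub>R g n x"
definition kb :: "nat \<Rightarrow> 'a \<Rightarrow> 'k" where
  "kb n x = sin (\<theta> n) *\<^sub>R fa n x + (cos (\<theta> n) - 1) *\<^sub>R fb n x"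
definition k :: "nat \<Rightarrow> 'a \<Rightarrow> 'a" where "k n x = sc (ka n x) (a n) + sc (kb n x) (b n)"
definition K :: "'a \<Rightarrow> 'a" where "K x = (\<Sum>n. k n x)"
definition R :: "'a \<Rightarrow>\<^sub>L 'a" where "R = Blinfun (\<lambda>x. J x + K x)"

lemma functional_scaleR_fun: "functional F \<Longrightarrow> functional (\<lambda>x. r *\<^sub>R F x)"
  using functional_cmult[of F "of_real r"] by (simp add: scaleR_conv_of_real)

lemma functional_plus: "functional F \<Longrightarrow> functional G \<Longrightarrow> functional (\<lambda>x. F x + G x)"
  unfolding functional_def by (auto intro: bounded_linear_add simp: algebra_simps)

lemma functional_ka: "functional (ka n)" and functional_kb: "functional (kb n)"
  unfolding ka_def kb_def
  by (intro functional_plus functional_sub functional_scaleR_fun functionals functional_g)+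

lemma norm_rotation_le:
  fixes u v :: "'k"
  assumes "norm u \<le> M" "norm v \<le> M" "0 \<le> s" "\<bar>r\<bar> \<le> s" "\<bar>r'\<bar> \<le> s"
  shows "norm (r *\<^sub>R u + r' *\<^sub>R v) \<le> 2 * s * M"
proof -
  have "norm (r *\<^sub>R u + r' *\<^sub>R v) \<le> \<bar>r\<bar> * norm u + \<bar>r'\<bar> * norm v"
    using norm_triangle_ineq[of "r *\<^sub>R u" "r' *\<^sub>R v"] by simp
  also have "\<dots> \<le> s * M + s * M" by (intro add_mono mult_mono assms) (use assms in auto)
  finally show ?thesis by (simp add: mult_ac)
qed

lemma norm_block_rotation_le:
  assumes "0 \<le> t"
  shows "norm ((cos t - 1) *\<^sub>R fa n x - sin t *\<^sub>R fb n x) \<le> 2 * t * (C * norm x)"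
    and "norm (sin t *\<^sub>R fa n x + (cos t - 1) *\<^sub>R fb n x) \<le> 2 * t * (C * norm x)"
  using norm_rotation_le[OF bounds(3) bounds(4) assms, where r = "cos t - 1" and r' = "- sin t"]
    norm_rotation_le[OF bounds(3) bounds(4) assms, where r = "sin t" and r' = "cos t - 1"]
    abs_cos_minus_one_le[of t] abs_sin_x_le_abs_x[of t] assms
  by auto

lemma norm_ka_le: "norm (ka n x) \<le> (2 * C * \<theta> n + 2 * C * \<epsilon> n) * norm x"
proof -
  have "norm (ka n x) \<le> norm ((cos (\<theta> n) - 1) *\<^sub>R fa n x - sin (\<theta> n) *\<^sub>R fb n x) + \<epsilon> n * norm (g n x)"
    unfolding ka_def using eps_pos[of n] by (intro order_trans[OF norm_triangle_ineq]) simp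
  also have "\<dots> \<le> 2 * \<theta> n * (C * norm x) + \<epsilon> n * (2 * (C * norm x))"
    using norm_block_rotation_le(1)[of "\<theta> n" n x] theta_pos[of n] eps_pos[of n]
      norm_g_le[of n x] bounds(5,6)[of x]
    by (intro add_mono mult_left_mono) auto
  finally show ?thesis by (simp add: algebra_simps)
qed

lemma norm_kb_le: "norm (kb n x) \<le> 2 * C * \<theta> n * norm x"
  unfolding kb_def using norm_block_rotation_le(2)[of "\<theta> n" n x] theta_pos[of n]
  by (simp add: algebra_simps)

lemma norm_k_le: "norm (k n x) \<le> (2 * C\<^sup>2 * (2 * \<theta> n + \<epsilon> n)) * norm x"
proof -
  have "norm (k n x) \<le> norm (ka n x) * norm (a n) + norm (kb n x) * norm (b n)"
    unfolding k_def by (intro order_trans[OF norm_triangle_ineq]) (simp add: norm_scale)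
  also have "\<dots> \<le> (2 * C * \<theta> n + 2 * C * \<epsilon> n) * norm x * C + 2 * C * \<theta> n * norm x * C"
    using C_pos theta_pos[of n] eps_pos[of n]
    by (intro add_mono mult_mono norm_ka_le norm_kb_le bounds) auto
  finally show ?thesis by (simp add: algebra_simps power2_eq_square)
qed

lemma bounded_linear_k: "bounded_linear (k n)"
  unfolding k_def
  by (intro bounded_linear_add bounded_linear_compose[OF bounded_linear_sc_left]
      functional_bounded_linear functional_ka functional_kb)

lemma summable_k_bound: "summable (\<lambda>n. 2 * C\<^sup>2 * (2 * \<theta> n + \<epsilon> n))"
  by (intro summable_mult summable_add summable_theta summable_eps)

lemma sums_K: "(\<lambda>n. k n x) sums K x"
  unfolding K_def by (rule sums_bounded_linear[OF bounded_linear_k norm_k_le summable_k_bound])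

lemma bounded_linear_K: "bounded_linear K"
  unfolding K_def by (rule bounded_linear_suminf(2)[OF bounded_linear_k norm_k_le summable_k_bound])

lemma K_sc: "K (sc r x) = sc r (K x)"
proof -
  have "(\<lambda>n. sc r (k n x)) sums sc r (K x)"
    by (rule bounded_linear.sums[OF bounded_linear_sc_right sums_K])
  moreover have "sc r (k n x) = k n (sc r x)" for n
    by (simp add: k_def functional_scale[OF functional_ka] functional_scale[OF functional_kb]
        scale_right_distrib)
  ultimately have "(\<lambda>n. k n (sc r x)) sums sc r (K x)" by simp
  then show ?thesis by (rule sums_unique2[OF sums_K])
qed

lemma K_eq_0:
  assumes "\<And>n. fa n x = 0" "\<And>n. fb n x = 0" "p x = 0" "q x = 0"
  shows "K x = 0"
  using assms by (simp add: K_def k_def ka_def kb_def g_def)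

lemma R_apply: "blinfun_apply R x = J x + K x"
  unfolding R_def
  by (subst bounded_linear_Blinfun_apply) (auto intro: bounded_linear_add bounded_linear_J bounded_linear_K)

lemma R_bounded_ops: "R \<in> bounded_ops sc"
  by (simp add: bounded_ops_def R_apply J_sc K_sc scale_right_distrib)

lemma functional_K:
  assumes F: "functional F"
  shows "(\<lambda>n. ka n x * F (a n) + kb n x * F (b n)) sums F (K x)"
  using bounded_linear.sums[OF functional_bounded_linear[OF F] sums_K[of x]]
  by (simp add: k_def functional_add[OF F] functional_scale[OF F])

lemma fa_K: "fa n (K x) = ka n x" and fb_K: "fb n (K x) = kb n x"
proof -
  have "(\<lambda>l. ka l x * fa n (a l) + kb l x * fa n (b l)) = (\<lambda>l. if l = n then ka l x else 0)"
    "(\<lambda>l. ka l x * fb n (a l) + kb l x * fb n (b l)) = (\<lambda>l. if l = n then kb l x else 0)"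
    by (auto simp: fa_ab fb_ab)
  then have "(\<lambda>l. if l = n then ka l x else 0) sums fa n (K x)"
    "(\<lambda>l. if l = n then kb l x else 0) sums fb n (K x)"
    using functional_K[OF functionals(1), of x n] functional_K[OF functionals(2), of x n] by auto
  from sums_unique2[OF this(1) sums_single] sums_unique2[OF this(2) sums_single]
  show "fa n (K x) = ka n x" "fb n (K x) = kb n x" .
qed

lemma p_K: "p (K x) = 0" and q_K: "q (K x) = 0"
proof -
  have "(\<lambda>n. 0) sums p (K x)" "(\<lambda>n. 0) sums q (K x)"
    using functional_K[OF functionals(3), of x] functional_K[OF functionals(4), of x]
    by (simp_all add: pq_ab)
  from sums_unique2[OF this(1) sums_zero] sums_unique2[OF this(2) sums_zero]
  show "p (K x) = 0" "q (K x) = 0" .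
qed

lemma J_K: "J (K x) = K x"
proof -
  have "(\<lambda>n. J (k n x)) sums J (K x)" by (rule bounded_linear.sums[OF bounded_linear_J sums_K])
  moreover have "J (k n x) = k n x" for n
    by (simp add: k_def linear_simps(1)[OF bounded_linear_J] J_sc J_ab)
  ultimately have "(\<lambda>n. k n x) sums J (K x)" by simp
  then show ?thesis by (rule sums_unique2[OF _ sums_K])
qed

section \<open>Orbits in block coordinates\<close>

definition orbit :: "nat \<Rightarrow> 'a \<Rightarrow> 'a" where "orbit t = blinfun_apply R ^^ t"

lemma orbit_0: "orbit 0 x = x" and orbit_Suc: "orbit (Suc t) x = J (orbit t x) + K (orbit t x)"
  by (auto simp: orbit_def R_apply)

text \<open>Since \<open>p\<close> and \<open>q\<close> are invariants, the drift of a block adds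
  the same amount at each step.\<close>

lemma p_orbit: "p (orbit t x) = p x" and q_orbit: "q (orbit t x) = q x"
  by (induction t) (auto simp: orbit_0 orbit_Suc functional_add functionals J_fix p_K q_K)

lemma g_orbit: "g n (orbit t x) = g n x"
  by (simp add: g_def p_orbit q_orbit)

text \<open>Formally z_t = exp (\<i> t \<theta>) z_0 + \<epsilon> g S_t with S_t a geometric sum.
  Both coordinates are treated together because each step of the induction mixes them.\<close>

lemma fa_fb_orbit:
  "fa n (orbit t x) = cos (real t * \<theta> n) *\<^sub>R fa n x - sin (real t * \<theta> n) *\<^sub>R fb n x
     + (\<epsilon> n * (\<Sum>i<t. cos (real i * \<theta> n))) *\<^sub>R g n x \<and>
   fb n (orbit t x) = sin (real t * \<theta> n) *\<^sub>R fa n x + cos (real t * \<theta> n) *\<^sub>R fb n x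
     + (\<epsilon> n * (\<Sum>i<t. sin (real i * \<theta> n))) *\<^sub>R g n x"
proof (induction t)
  case 0
  then show ?case by (simp add: orbit_0)
next
  case (Suc t)
  have fa: "fa n (orbit (Suc t) x) = cos (\<theta> n) *\<^sub>R fa n (orbit t x) - sin (\<theta> n) *\<^sub>R fb n (orbit t x)
      + \<epsilon> n *\<^sub>R g n x"
    by (simp add: orbit_Suc functional_add functionals J_fix fa_K ka_def g_orbit scaleR_left_diff_distrib)
  have fb: "fb n (orbit (Suc t) x) = sin (\<theta> n) *\<^sub>R fa n (orbit t x) + cos (\<theta> n) *\<^sub>R fb n (orbit t x)"
    by (simp add: orbit_Suc functional_add functionals J_fix fb_K kb_def scaleR_left_diff_distrib)
  have angle: "real (Suc t) * \<theta> n = \<theta> n + real t * \<theta> n" by (simp add: distrib_right)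
  show ?case
    unfolding fa fb cos_sum_rotate sin_sum_rotate angle cos_add sin_add
      Suc.IH[THEN conjunct1] Suc.IH[THEN conjunct2]
    by (simp add: algebra_simps)
qed

lemma fa_orbit: "fa n (orbit t x) = cos (real t * \<theta> n) *\<^sub>R fa n x - sin (real t * \<theta> n) *\<^sub>R fb n x
     + (\<epsilon> n * (\<Sum>i<t. cos (real i * \<theta> n))) *\<^sub>R g n x"
  and fb_orbit: "fb n (orbit t x) = sin (real t * \<theta> n) *\<^sub>R fa n x + cos (real t * \<theta> n) *\<^sub>R fb n x
     + (\<epsilon> n * (\<Sum>i<t. sin (real i * \<theta> n))) *\<^sub>R g n x"
  using fa_fb_orbit by blast+

text \<open>The blocks need not span the space, so coordinates alone do not determine an orbit. This
  predicate singles out the vectors that their block coordinates do determine and that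
  \<open>J\<close> fixes.\<close>

definition block_sum :: "'a \<Rightarrow> bool" where
  "block_sum z \<longleftrightarrow> (\<lambda>n. sc (fa n z) (a n) + sc (fb n z) (b n)) sums z \<and> J z = z"

lemma block_sum_add:
  assumes "block_sum y" "block_sum z"
  shows "block_sum (y + z)"
proof -
  have "(\<lambda>n. (sc (fa n y) (a n) + sc (fb n y) (b n)) + (sc (fa n z) (a n) + sc (fb n z) (b n))) sums (y + z)"
    using assms unfolding block_sum_def by (intro sums_add) auto
  moreover have "(sc (fa n y) (a n) + sc (fb n y) (b n)) + (sc (fa n z) (a n) + sc (fb n z) (b n)) =
      sc (fa n (y + z)) (a n) + sc (fb n (y + z)) (b n)" for n
    by (simp add: functional_add functionals scale_left_distrib)
  moreover have "J (y + z) = y + z"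
    using assms by (simp add: block_sum_def linear_simps(1)[OF bounded_linear_J])
  ultimately show ?thesis by (simp add: block_sum_def)
qed

lemma block_sum_K: "block_sum (K x)"
  using sums_K[of x] by (simp add: block_sum_def fa_K fb_K k_def J_K)

text \<open>Each step adds a value of \<open>K\<close>, itself a block sum, while \<open>J\<close>
  fixes what has been accumulated.\<close>

lemma block_sum_orbit_diff: "block_sum (orbit t x - (J ^^ t) x)"
proof (induction t)
  case 0
  then show ?case
    by (simp add: block_sum_def orbit_0 linear_simps(3)[OF bounded_linear_J]
        functional_zero functionals)
next
  case (Suc t)
  have "J (orbit t x) - J ((J ^^ t) x) = orbit t x - (J ^^ t) x"
    using Suc by (simp add: block_sum_def linear_simps(2)[OF bounded_linear_J])
  then have "orbit (Suc t) x - (J ^^ Suc t) x = (orbit t x - (J ^^ t) x) + K (orbit t x)"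
    by (simp add: orbit_Suc algebra_simps)
  then show ?case using block_sum_add[OF Suc block_sum_K] by simp
qed

lemma J_even: "even t \<Longrightarrow> (J ^^ t) x = x"
proof -
  have "(J ^^ (2 * s)) x = x" for s by (induction s) (auto simp: J_J)
  then show "even t \<Longrightarrow> (J ^^ t) x = x" by (auto elim: evenE)
qed

lemma sums_orbit_diff:
  assumes "even t"
  shows "(\<lambda>n. sc (fa n (orbit t x) - fa n x) (a n) + sc (fb n (orbit t x) - fb n x) (b n)) sums
    (orbit t x - x)"
  using block_sum_orbit_diff[of t x] J_even[OF assms]
  by (simp add: block_sum_def functional_diff functionals)

section \<open>Recurrence along the times \<open>m N\<close>\<close>

text \<open>Time \<open>m N\<close> is a whole number of periods of block \<open>n\<close>: the
  rotation returns, and the constant drift cancels over full turns.\<close>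

lemma coordinates_periodic:
  assumes "n < N"
  shows "fa n (orbit (m N) x) = fa n x" and "fb n (orbit (m N) x) = fb n x"
proof -
  obtain d where d: "m N = m (Suc n) * d" using m_dvd[of "Suc n" N] assms by (auto elim: dvdE)
  have angle: "real (m N) * \<theta> n = 2 * pi * real d"
    using m_pos[of "Suc n"] by (simp add: d \<theta>_def)
  \<comment> \<open>A period of at least 4 puts the angle strictly between 0 and \<pi>, which
    excludes the trivial rotation, where drifts would add up.\<close>
  have "m n \<ge> 2" using even_m[of n] m_pos[of n] by (auto elim!: evenE)
  then have m4: "m (Suc n) \<ge> 4" using m_double_le[of n] by linarith
  have "\<theta> n < pi" "0 < \<theta> n"
    using m4 theta_pos by (auto simp: \<theta>_def field_simps)
  then have "cos (\<theta> n) \<noteq> 1" using sin_gt_zero[of "\<theta> n"] cos_one_sin_zero[of "\<theta> n"] by auto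
  moreover have "cos (real (m N) * \<theta> n) = 1" "sin (real (m N) * \<theta> n) = 0"
    unfolding angle by (simp_all add: cos_int_2pin[of "int d", simplified] sin_int_2pin[of "int d", simplified])
  ultimately show "fa n (orbit (m N) x) = fa n x" "fb n (orbit (m N) x) = fb n x"
    using trig_sum_period[of "m N" "\<theta> n"] by (simp_all add: fa_orbit fb_orbit)
qed

lemma coordinates_drift:
  shows "norm (fa n (orbit t x) - fa n x) \<le> 2 * (t * \<theta> n) * (C * norm x) + \<epsilon> n * t * norm (g n x)"
    and "norm (fb n (orbit t x) - fb n x) \<le> 2 * (t * \<theta> n) * (C * norm x) + \<epsilon> n * t * norm (g n x)"
proof -
  have t: "0 \<le> t * \<theta> n" using theta_pos[of n] by simp
  have cs: "\<bar>\<Sum>i<t. cos (real i * \<theta> n)\<bar> \<le> t" "\<bar>\<Sum>i<t. sin (real i * \<theta> n)\<bar> \<le> t"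
    using sum_bounded_above[of "{..<t}" "\<lambda>i. \<bar>cos (real i * \<theta> n)\<bar>" 1]
      sum_bounded_above[of "{..<t}" "\<lambda>i. \<bar>sin (real i * \<theta> n)\<bar>" 1]
    by (auto intro: order_trans[OF sum_abs])
  have le: "norm ((\<epsilon> n * r) *\<^sub>R g n x) \<le> \<epsilon> n * t * norm (g n x)" if "\<bar>r\<bar> \<le> t" for r :: real
    using that eps_pos[of n] by (simp add: abs_mult mult_right_mono mult_left_mono)
  have "fa n (orbit t x) - fa n x = ((cos (t * \<theta> n) - 1) *\<^sub>R fa n x - sin (t * \<theta> n) *\<^sub>R fb n x)
      + (\<epsilon> n * (\<Sum>i<t. cos (real i * \<theta> n))) *\<^sub>R g n x"
    by (simp add: fa_orbit algebra_simps)
  then show "norm (fa n (orbit t x) - fa n x) \<le> 2 * (t * \<theta> n) * (C * norm x) + \<epsilon> n * t * norm (g n x)"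
    using norm_triangle_mono[OF norm_block_rotation_le(1)[OF t] le[OF cs(1)]] by simp
  have "fb n (orbit t x) - fb n x = (sin (t * \<theta> n) *\<^sub>R fa n x + (cos (t * \<theta> n) - 1) *\<^sub>R fb n x)
      + (\<epsilon> n * (\<Sum>i<t. sin (real i * \<theta> n))) *\<^sub>R g n x"
    by (simp add: fb_orbit algebra_simps)
  then show "norm (fb n (orbit t x) - fb n x) \<le> 2 * (t * \<theta> n) * (C * norm x) + \<epsilon> n * t * norm (g n x)"
    using norm_triangle_mono[OF norm_block_rotation_le(2)[OF t] le[OF cs(2)]] by simp
qed

text \<open>Blocks below \<open>N\<close> have returned exactly, block \<open>N\<close> contributes
  its full drift, and the rotations from \<open>N\<close> on and the drifts beyond \<open>N\<close>
  form a geometric tail. The factor 2 C comes from the two vectors of a block.\<close>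

lemma norm_orbit_m_diff_le:
  "norm (orbit (m N) x - x) \<le> 2 * C * (c N * norm (g N x)
     + 2 * (1 / 2) ^ N * (2 * pi * C * norm x + norm (p x) + norm (q x)))"
proof -
  define H where "H = 2 * pi * C * norm x + norm (p x) + norm (q x)"
  define \<beta> where "\<beta> n = (if n = N then c n * norm (g n x) else 0) + (if N \<le> n then (1 / 2) ^ n else 0) * H"
    for n
  have geo: "(\<lambda>n. if N \<le> n then (1 / 2 :: real) ^ n else 0) sums (2 * (1 / 2) ^ N)"
  proof -
    have "(\<lambda>n. (1 / 2 :: real) ^ N * (1 / 2) ^ n) sums ((1 / 2) ^ N * 2)"
      using sums_mult[OF geometric_sums[of "1 / 2 :: real"]] by simp
    then have "(\<lambda>n. if N \<le> n + N then (1 / 2 :: real) ^ (n + N) else 0) sums (2 * (1 / 2) ^ N)"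
      by (simp add: power_add mult.commute)
    then show ?thesis by (subst (asm) sums_iff_shift) simp
  qed
  have coord: "norm (fa n (orbit (m N) x) - fa n x) \<le> \<beta> n" "norm (fb n (orbit (m N) x) - fb n x) \<le> \<beta> n"
    for n
  proof -
    have "2 * (m N * \<theta> n) * (C * norm x) + \<epsilon> n * m N * norm (g n x) \<le> \<beta> n" if "N \<le> n"
    proof -
      have 1: "2 * (m N * \<theta> n) * (C * norm x) \<le> 2 * (pi * (1 / 2) ^ n) * (C * norm x)"
        using C_pos m_theta_le[OF that] by (intro mult_right_mono mult_left_mono) auto
      have gH: "0 \<le> (1 / 2) ^ n * (norm (p x) + norm (q x))" by simp
      have 2: "\<epsilon> n * m N * norm (g n x) \<le>
          (if n = N then c n * norm (g n x) else 0) + (1 / 2) ^ n * (norm (p x) + norm (q x))"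
      proof (cases "n = N")
        case True
        then show ?thesis using m_pos[of N] gH by (simp add: \<epsilon>_def)
      next
        case False
        have "\<epsilon> n * m N * norm (g n x) \<le> (1 / 2) ^ n * (norm (p x) + norm (q x))"
          using m_ratio_le[of N n] False that by (intro mult_mono norm_g_le) (auto simp: \<epsilon>_def)
        then show ?thesis using False by simp
      qed
      show ?thesis
        unfolding \<beta>_def H_def using add_mono[OF 1 2] that by (simp add: algebra_simps)
    qed
    moreover have "0 \<le> \<beta> n"
      using C_pos by (simp add: \<beta>_def H_def)
    ultimately show "norm (fa n (orbit (m N) x) - fa n x) \<le> \<beta> n"
      "norm (fb n (orbit (m N) x) - fb n x) \<le> \<beta> n"
      using coordinates_drift[of n "m N" x] coordinates_periodic[of n N x]
      by (cases "N \<le> n"; force)+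
  qed
  have "norm (sc (fa n (orbit (m N) x) - fa n x) (a n) + sc (fb n (orbit (m N) x) - fb n x) (b n))
      \<le> \<beta> n * (2 * C)" for n
  proof -
    have "\<beta> n \<ge> 0" using coord(1)[of n] norm_ge_zero order_trans by blast
    then have "norm (sc (fa n (orbit (m N) x) - fa n x) (a n) + sc (fb n (orbit (m N) x) - fb n x) (b n))
        \<le> \<beta> n * C + \<beta> n * C"
      by (intro norm_triangle_mono) (auto simp: norm_scale intro!: mult_mono coord bounds)
    then show ?thesis by (simp add: mult_ac)
  qed
  moreover have "(\<lambda>n. \<beta> n * (2 * C)) sums ((c N * norm (g N x) + 2 * (1 / 2) ^ N * H) * (2 * C))"
    unfolding \<beta>_def by (intro sums_mult2 sums_add geo sums_single)
  ultimately have "norm (orbit (m N) x - x) \<le> (c N * norm (g N x) + 2 * (1 / 2) ^ N * H) * (2 * C)"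
    using norm_sums_le[OF sums_orbit_diff[OF even_m]] by blast
  then show ?thesis by (simp add: H_def mult.commute)
qed

text \<open>Divide by \<open>q x\<close>: the quotient lies in the unit disc, where \<open>w\<close>
  approximates every point faster than \<open>c\<close> grows along a subsequence. If
  \<open>q x\<close> is 0, so is \<open>p x\<close>.\<close>

lemma frequently_c_g_small:
  assumes "norm (p x) \<le> norm (q x)" and "\<eta> > 0"
  shows "\<exists>\<^sub>F n in sequentially. c n * norm (g n x) < \<eta>"
proof (cases "q x = 0")
  case True
  then have "g n x = 0" for n using assms(1) by (simp add: g_def)
  then show ?thesis using assms(2) by simp
next
  case False
  have "norm (p x / q x) \<le> 1" using assms(1) False by (simp add: norm_divide)
  moreover have "\<eta> / norm (q x) > 0" using False assms(2) by simp
  ultimately have "\<exists>\<^sub>F n in sequentially. c n * norm (p x / q x - w n) < \<eta> / norm (q x)"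
    by (rule w_approx)
  moreover have "c n * norm (g n x) < \<eta>" if "c n * norm (p x / q x - w n) < \<eta> / norm (q x)" for n
  proof -
    have "g n x = (p x / q x - w n) * q x" using False by (simp add: g_def left_diff_distrib)
    then have "norm (g n x) = norm (p x / q x - w n) * norm (q x)" by (simp only: norm_mult)
    then show ?thesis using that False by (simp add: pos_less_divide_eq mult.assoc)
  qed
  ultimately show ?thesis by (rule frequently_elim1)
qed

lemma B_set_supset: "norm (p x) \<le> norm (q x) \<Longrightarrow> x \<in> B_set R"
proof -
  assume pq: "norm (p x) \<le> norm (q x)"
  have close: "\<exists>\<^sub>F t in sequentially. norm (orbit t x - x) < \<eta>" if "\<eta> > 0" for \<eta>
    unfolding frequently_sequentially
  proof
    fix N\<^sub>0
    \<comment> \<open>The drift of block \<open>N\<close> and the tail are each made smaller than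
      this, and both are multiplied by 2 C.\<close>
    define \<eta>' where "\<eta>' = \<eta> / (4 * C)"
    have \<eta>': "\<eta>' > 0" using that C_pos by (simp add: \<eta>'_def)
    define H where "H = 2 * pi * C * norm x + norm (p x) + norm (q x)"
    have "(\<lambda>N. 2 * (1 / 2) ^ N * H) \<longlonglongrightarrow> 2 * 0 * H"
      by (intro tendsto_intros LIMSEQ_power_zero) auto
    then have "\<forall>\<^sub>F N in sequentially. 2 * (1 / 2) ^ N * H < \<eta>'"
      using \<eta>' by (intro order_tendstoD(2)[of _ "2 * 0 * H"]) auto
    then have "\<forall>\<^sub>F N in sequentially. 2 * (1 / 2) ^ N * H < \<eta>' \<and> N\<^sub>0 \<le> N"
      by (intro eventually_conj eventually_ge_at_top)
    from frequently_eventually_conj[OF frequently_c_g_small[OF pq \<eta>'] this]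
    obtain N where N: "c N * norm (g N x) < \<eta>'" "2 * (1 / 2) ^ N * H < \<eta>'" "N\<^sub>0 \<le> N"
      by (auto dest!: frequently_ex)
    have "norm (orbit (m N) x - x) \<le> 2 * C * (c N * norm (g N x) + 2 * (1 / 2) ^ N * H)"
      using norm_orbit_m_diff_le[of N x] by (simp add: H_def)
    also have "\<dots> < 2 * C * (\<eta>' + \<eta>')" using N C_pos by (intro mult_strict_left_mono add_strict_mono) auto
    also have "\<dots> = \<eta>" using C_pos by (simp add: \<eta>'_def field_simps)
    finally show "\<exists>t\<ge>N\<^sub>0. norm (orbit t x - x) < \<eta>"
      using less_m[of N] N(3) by (intro exI[of _ "m N"]) auto
  qed
  let ?L = "liminf (\<lambda>t. ereal (norm (orbit t x - x)))"
  have "?L \<ge> 0" by (rule Liminf_bounded) simp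
  moreover have "\<not> 0 < ?L"
  proof
    assume "0 < ?L"
    then obtain \<eta> where "0 < ereal \<eta>" "ereal \<eta> < ?L" using ereal_dense2 by blast
    then have "\<forall>\<^sub>F t in sequentially. ereal \<eta> < ereal (norm (orbit t x - x))"
      by (intro less_LiminfD)
    moreover have "\<eta> > 0" using \<open>0 < ereal \<eta>\<close> by simp
    ultimately show False
      using close[of \<eta>] unfolding frequently_def
      by (auto elim!: notE eventually_mono)
  qed
  ultimately have "?L = 0" by simp
  then show "x \<in> B_set R" by (simp add: B_set_def orbit_def)
qed

section \<open>Escape to infinity\<close>

text \<open>Up to a sixth of the period the angle stays below \<pi> / 3, so every cosine is at least
  1 / 2.\<close>

lemma cos_sum_ge:
  assumes "6 * t \<le> m (Suc n)"
  shows "(\<Sum>i<t. cos (real i * \<theta> n)) \<ge> t / 2"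
proof -
  have "1 / 2 \<le> cos (real i * \<theta> n)" if "i < t" for i
  proof -
    have "6 * real i \<le> m (Suc n)" using assms that by linarith
    then have "real i * \<theta> n \<le> pi / 3" using m_pos[of "Suc n"] by (simp add: \<theta>_def field_simps)
    then have "cos (pi / 3) \<le> cos (real i * \<theta> n)"
      using theta_pos[of n] by (intro cos_monotone_0_pi_le) auto
    then show ?thesis by (simp add: cos_60)
  qed
  then have "(\<Sum>i<t. 1 / 2) \<le> (\<Sum>i<t. cos (real i * \<theta> n))" by (intro sum_mono) auto
  then show ?thesis by simp
qed

lemma m_interval:
  assumes "m N \<le> s"
  obtains n where "N \<le> n" "m n \<le> s" "s < m (Suc n)"
proof -
  have "\<exists>n\<ge>N. m n \<le> s \<and> s < m (Suc n)"
  proof (rule ccontr)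
    assume *: "\<not> ?thesis"
    have "m n \<le> s" if "N \<le> n" for n
      using that by (induction rule: dec_induct) (use assms * in \<open>auto simp: not_less\<close>)
    from this[of "max N s"] less_m[of "max N s"] show False by auto
  qed
  then show thesis using that by blast
qed

text \<open>The witnessing block changes with time. At time t take \<open>n\<close> with m n \<le> 6
  t < m (n + 1): its drifts still point in similar directions and have had time to reach a multiple
  of \<open>c n\<close>, while the rotated initial coordinates contribute at most 2 C times the norm
  of \<open>x\<close>.\<close>

lemma A_set_supset: "norm (q x) < norm (p x) \<Longrightarrow> x \<in> A_set R"
proof -
  assume pq: "norm (q x) < norm (p x)"
  define \<delta> where "\<delta> = norm (p x) - norm (q x)"
  have \<delta>: "\<delta> > 0" using pq by (simp add: \<delta>_def)
  have "\<forall>\<^sub>F t in sequentially. Z \<le> norm (orbit t x)" for Z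
  proof -
    have "\<forall>\<^sub>F n in sequentially. nat \<lceil>12 * (C * Z + 2 * (C * norm x)) / \<delta>\<rceil> \<le> c n"
      using c_at_top unfolding filterlim_at_top by blast
    then obtain N where N: "\<And>n. n \<ge> N \<Longrightarrow> nat \<lceil>12 * (C * Z + 2 * (C * norm x)) / \<delta>\<rceil> \<le> c n"
      by (auto simp: eventually_sequentially)
    have "Z \<le> norm (orbit t x)" if "t \<ge> m N" for t
    proof -
      have "m N \<le> 6 * t" using that by simp
      then obtain n where n: "N \<le> n" "m n \<le> 6 * t" "6 * t < m (Suc n)" by (rule m_interval)
      have "12 * (C * Z + 2 * (C * norm x)) / \<delta> \<le> c n" using N[OF n(1)] by linarith
      then have 1: "C * Z + 2 * (C * norm x) \<le> c n / 12 * \<delta>" using \<delta> by (simp add: field_simps)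
      \<comment> \<open>Here t \<ge> m n / 6, and the cosine sum is at least t / 2; this is the
        source of the 12 in the choice of \<open>N\<close>.\<close>
      have "c n / 12 \<le> \<epsilon> n * (t / 2)"
      proof -
        have "c n * (real (m n) / 12) \<le> c n * (t / 2)" using n(2) by (intro mult_left_mono) auto
        then show ?thesis using m_pos[of n] by (simp add: \<epsilon>_def field_simps)
      qed
      also have "\<dots> \<le> \<epsilon> n * (\<Sum>i<t. cos (real i * \<theta> n))"
        using cos_sum_ge[of t n] n(3) eps_pos[of n] by (intro mult_left_mono) auto
      finally have amplitude: "c n / 12 \<le> \<epsilon> n * (\<Sum>i<t. cos (real i * \<theta> n))" .
      moreover have "0 \<le> c n / 12" by simp
      ultimately have "0 \<le> \<epsilon> n * (\<Sum>i<t. cos (real i * \<theta> n))" by linarith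
      moreover have "c n / 12 * \<delta> \<le> \<epsilon> n * (\<Sum>i<t. cos (real i * \<theta> n)) * norm (g n x)"
        using g_ge[of x n] \<delta> calculation by (intro mult_mono amplitude) (simp_all only: \<delta>_def)
      ultimately have "c n / 12 * \<delta> \<le> norm ((\<epsilon> n * (\<Sum>i<t. cos (real i * \<theta> n))) *\<^sub>R g n x)"
        by (simp only: norm_scaleR abs_of_nonneg)
      also have "\<dots> \<le> norm (fa n (orbit t x)) + norm (cos (t * \<theta> n) *\<^sub>R fa n x - sin (t * \<theta> n) *\<^sub>R fb n x)"
        using norm_triangle_ineq4[of "fa n (orbit t x)"
            "cos (t * \<theta> n) *\<^sub>R fa n x - sin (t * \<theta> n) *\<^sub>R fb n x"]
        by (simp add: fa_orbit)
      also have "\<dots> \<le> C * norm (orbit t x) + 2 * (C * norm x)"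
        using norm_rotation_le[OF bounds(3) bounds(4), of 1 "cos (t * \<theta> n)" "- sin (t * \<theta> n)" n x n]
        by (intro add_mono bounds) auto
      finally have "C * Z \<le> C * norm (orbit t x)" using 1 by linarith
      then show ?thesis using C_pos by simp
    qed
    then show ?thesis unfolding eventually_sequentially by blast
  qed
  then show "x \<in> A_set R" by (simp add: A_set_def filterlim_at_top orbit_def)
qed

text \<open>The two inclusions already cover the space, and the sets are disjoint. The regions of
  strict inequality are open and contain \<open>e\<close> and \<open>e'\<close>,
  respectively.\<close>

lemma R_A_class: "R \<in> A_class sc"
proof -
  have cont: "continuous_on UNIV (\<lambda>x. norm (p x))" "continuous_on UNIV (\<lambda>x. norm (q x))"
    by (intro continuous_on_norm linear_continuous_on functional_bounded_linear functionals)+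
  have "{x. norm (q x) < norm (p x)} \<subseteq> interior (A_set R)"
    by (intro interior_maximal open_Collect_less cont) (use A_set_supset in auto)
  moreover have "e \<in> {x. norm (q x) < norm (p x)}" by (simp add: pq_e)
  ultimately have A: "interior (A_set R) \<noteq> {}" by blast
  have "{x. norm (p x) < norm (q x)} \<subseteq> interior (B_set R)"
    by (intro interior_maximal open_Collect_less cont) (use B_set_supset in auto)
  moreover have "e' \<in> {x. norm (p x) < norm (q x)}" by (simp add: pq_e)
  ultimately have B: "interior (B_set R) \<noteq> {}" by blast
  have "x \<in> A_set R \<union> B_set R" for x
    using A_set_supset[of x] B_set_supset[of x] by (cases "norm (p x) \<le> norm (q x)") auto
  then have "A_set R \<union> B_set R = UNIV" by blast
  moreover have "A_set R \<noteq> {}" "B_set R \<noteq> {}" using A B by auto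
  ultimately have "partition_on UNIV {A_set R, B_set R}"
    using A_set_B_set_disjoint[of R] by (intro partition_onI) (auto simp: disjnt_def)
  then show ?thesis using A B R_bounded_ops by (simp add: A_class_def)
qed

text \<open>On the common kernel of the dynamical coordinates the perturbation vanishes. The vectors
  where values are to be prescribed will be placed there.\<close>

lemma exists_A_class_eq_J:
  "\<exists>L\<in>A_class sc. \<forall>x. (\<forall>n. fa n x = 0 \<and> fb n x = 0) \<and> p x = 0 \<and> q x = 0 \<longrightarrow>
     blinfun_apply L x = J x"
proof (intro bexI allI impI)
  fix x assume "(\<forall>n. fa n x = 0 \<and> fb n x = 0) \<and> p x = 0 \<and> q x = 0"
  then have "K x = 0" by (intro K_eq_0) auto
  then show "blinfun_apply R x = J x" by (simp add: R_apply)
qed (rule R_A_class)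

end

section \<open>Density\<close>

lemma exists_finite_net:
  assumes "r > 0"
  shows "\<exists>F. finite F \<and> F \<subseteq> cball (0::'k::{real_normed_field,heine_borel}) 1 \<and>
    (\<forall>z. norm z \<le> 1 \<longrightarrow> (\<exists>x\<in>F. norm (z - x) < r))"
proof -
  have "cball (0::'k) 1 \<subseteq> (\<Union>x\<in>cball 0 1. ball x r)" using assms by force
  then obtain F where "F \<subseteq> cball (0::'k) 1" "finite F" "cball 0 1 \<subseteq> (\<Union>x\<in>F. ball x r)"
    using compactE_image[OF compact_cball, of "cball 0 1" "\<lambda>x. ball x r" "0::'k" 1] open_ball by metis
  then show ?thesis by (force simp: dist_norm norm_minus_commute)
qed

text \<open>Concatenating finite nets of the unit disc, the \<open>j\<close>-th one of mesh \<open>1 / (j + 1)\<^sup>2\<close> and with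
  weight \<open>j + 1\<close>.\<close>

lemma exists_weighted_approximation:
  obtains c :: "nat \<Rightarrow> nat" and w :: "nat \<Rightarrow> 'k::{real_normed_field,heine_borel}"
  where "\<And>n. c n \<ge> 1" "filterlim c at_top sequentially" "\<And>n. norm (w n) \<le> 1"
    "\<And>z \<eta>. norm z \<le> 1 \<Longrightarrow> \<eta> > 0 \<Longrightarrow> \<exists>\<^sub>F n in sequentially. real (c n) * norm (z - w n) < \<eta>"
proof -
  have "\<exists>F. finite F \<and> F \<subseteq> cball (0::'k) 1 \<and>
      (\<forall>z. norm z \<le> 1 \<longrightarrow> (\<exists>x\<in>F. norm (z - x) < 1 / (real (Suc j))\<^sup>2))" for j
    by (rule exists_finite_net) simp
  then obtain F where F: "\<And>j. finite (F j)" "\<And>j. F j \<subseteq> cball (0::'k) 1"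
    "\<And>j z. norm z \<le> 1 \<Longrightarrow> \<exists>x\<in>F j. norm (z - x) < 1 / (real (Suc j))\<^sup>2"
    by metis
  \<comment> \<open>An arbitrary enumeration of the disjoint union of the nets suffices: each net is
    finite, so the net index tends to infinity along it.\<close>
  define P where "P = (SIGMA j:(UNIV::nat set). F j)"
  have "F j \<noteq> {}" for j using F(3)[of 0 j] by auto
  then have "fst ` P = UNIV" unfolding P_def by force
  then have "infinite P" using finite_imageI infinite_UNIV_nat by metis
  moreover have "countable P" unfolding P_def by (intro countable_SIGMA) (auto intro: countable_finite F)
  ultimately have bij: "bij_betw (from_nat_into P) UNIV P" by (intro bij_betw_from_nat_into)
  define h where "h = from_nat_into P"
  define c where "c n = Suc (fst (h n))" for n
  have inj: "inj h" and range: "range h = P" using bij by (auto simp: h_def bij_betw_def)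
  have hF: "snd (h n) \<in> F (fst (h n))" for n using range by (auto simp: P_def)
  show thesis
  proof (rule that[of c "\<lambda>n. snd (h n)"])
    show "c n \<ge> 1" for n by (simp add: c_def)
    show "norm (snd (h n)) \<le> 1" for n using hF[of n] F(2)[of "fst (h n)"] by auto
    show "filterlim c at_top sequentially"
      unfolding filterlim_at_top
    proof
      fix Z
      have "h ` {n. \<not> Z \<le> c n} \<subseteq> (SIGMA j:{..<Z}. F j)"
      proof
        fix y assume "y \<in> h ` {n. \<not> Z \<le> c n}"
        then obtain n where n: "y = h n" "c n < Z" by auto
        from n(2) have "fst (h n) \<in> {..<Z}" by (simp add: c_def)
        then have "(fst (h n), snd (h n)) \<in> (SIGMA j:{..<Z}. F j)" using hF[of n] by (rule SigmaI)
        then show "y \<in> (SIGMA j:{..<Z}. F j)" by (simp only: n prod.collapse)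
      qed
      moreover have "finite (SIGMA j:{..<Z}. F j)" by (intro finite_SigmaI F) simp
      ultimately have "finite {n. \<not> Z \<le> c n}"
        using finite_imageD finite_subset inj inj_on_subset by (metis subset_UNIV)
      then show "\<forall>\<^sub>F n in sequentially. Z \<le> c n"
        unfolding cofinite_eq_sequentially[symmetric] eventually_cofinite .
    qed
    fix z :: 'k and \<eta> :: real
    assume z: "norm z \<le> 1" and \<eta>: "\<eta> > 0"
    show "\<exists>\<^sub>F n in sequentially. real (c n) * norm (z - snd (h n)) < \<eta>"
      unfolding frequently_sequentially
    proof
      fix N
      obtain i where i: "1 / real (Suc i) < \<eta>" using \<eta> nat_approx_posE by metis
      \<comment> \<open>Adding the earlier weights forces a late position: every n < N has
        \<open>c n\<close> at most \<open>j\<close>, whereas a point of net \<open>j\<close> has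
        weight j + 1.\<close>
      define j where "j = i + (\<Sum>n<N. c n)"
      obtain x where x: "x \<in> F j" "norm (z - x) < 1 / (real (Suc j))\<^sup>2" using F(3)[OF z] by blast
      then have "(j, x) \<in> range h" unfolding range by (simp add: P_def)
      then obtain n where n: "h n = (j, x)" by (metis imageE)
      have "N \<le> n"
      proof (rule ccontr)
        assume "\<not> N \<le> n"
        then have "c n \<le> (\<Sum>n<N. c n)" by (intro member_le_sum) auto
        then show False by (simp add: c_def n j_def)
      qed
      moreover have "real (c n) * norm (z - snd (h n)) < \<eta>"
      proof -
        have "real (Suc j) * norm (z - x) < real (Suc j) * (1 / (real (Suc j))\<^sup>2)"
          using x(2) by (intro mult_strict_left_mono) auto
        also have "\<dots> = 1 / real (Suc j)" by (simp add: power2_eq_square)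
        also have "i \<le> j" by (simp add: j_def)
        then have "1 / real (Suc j) \<le> 1 / real (Suc i)" by (simp add: frac_le)
        finally show ?thesis using i by (simp add: c_def n)
      qed
      ultimately show "\<exists>n\<ge>N. real (c n) * norm (z - snd (h n)) < \<eta>" by blast
    qed
  qed
qed

section \<open>Approximation in the strong operator topology\<close>

lemma strong_operator_neighbourhood:
  fixes T :: "'a::real_normed_vector \<Rightarrow>\<^sub>L 'b::real_normed_vector"
  assumes "openin strong_operator_topology V" and "T \<in> V"
  obtains S \<epsilon> where "finite S" "\<epsilon> > 0" "\<And>R. (\<And>x. x \<in> S \<Longrightarrow>
      norm (blinfun_apply R x - blinfun_apply T x) < \<epsilon>) \<Longrightarrow> R \<in> V"
proof -
  obtain W :: "('a \<Rightarrow> 'b) set" where W: "open W" "V = blinfun_apply -` W"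
    using assms(1) unfolding strong_operator_topology_def openin_pullback_topology by auto
  have "openin (product_topology (\<lambda>i. euclidean) UNIV) W" using W(1) by (simp add: open_fun_def)
  moreover have "blinfun_apply T \<in> W" using assms(2) W(2) by simp
  ultimately obtain X where X: "blinfun_apply T \<in> Pi\<^sub>E UNIV X" "\<And>i. open (X i)"
    "finite {i. X i \<noteq> UNIV}" "Pi\<^sub>E UNIV X \<subseteq> W"
    using product_topology_open_contains_basis by (force simp flip: open_openin)
  have "\<exists>e>0. ball (blinfun_apply T i) e \<subseteq> X i" for i
    using X(1,2) open_contains_ball by (metis PiE_E UNIV_I)
  then obtain e where e: "\<And>i. e i > 0" "\<And>i. ball (blinfun_apply T i) (e i) \<subseteq> X i" by metis
  define S where "S = {i. X i \<noteq> UNIV}"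
  \<comment> \<open>The additional 1 keeps the minimum meaningful when no coordinate is
    restricted.\<close>
  have fin: "finite (Set.insert 1 (e ` S))" using X(3) by (simp add: S_def)
  show thesis
  proof (rule that[of S "Min (Set.insert 1 (e ` S))"])
    show "finite S" using X(3) by (simp add: S_def)
    show "0 < Min (Set.insert 1 (e ` S))" using fin e(1) by (subst Min_gr_iff) auto
    fix R :: "'a \<Rightarrow>\<^sub>L 'b"
    assume R: "\<And>x. x \<in> S \<Longrightarrow> norm (blinfun_apply R x - blinfun_apply T x) < Min (Set.insert 1 (e ` S))"
    have "blinfun_apply R i \<in> X i" for i
    proof (cases "i \<in> S")
      case True
      then have "norm (R i - T i) < e i"
        using R[OF True] Min_le[OF fin, of "e i"] by force
      then show ?thesis using e(2)[of i] by (auto simp: dist_norm norm_minus_commute)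
    next
      case False
      then show ?thesis by (simp add: S_def)
    qed
    then have "blinfun_apply R \<in> Pi\<^sub>E UNIV X" by auto
    then show "R \<in> V" using X(4) W(2) by auto
  qed
qed

context separated_space
begin

text \<open>Only finitely many vectors \<open>v j\<close> matter. The operator sends each exactly to
  a chosen vector near \<open>T (v j)\<close>, and all further members of the biorthogonal sequence
  are free for the dynamics.\<close>

lemma A_class_approximates:
  assumes inf: "infinite_dim sc UNIV" and T: "T \<in> bounded_ops sc" and S: "finite S" and \<epsilon>: "\<epsilon> > 0"
  shows "\<exists>R\<in>A_class sc. \<forall>x\<in>S. norm (blinfun_apply R x - blinfun_apply T x) < \<epsilon>"
proof -
  obtain n v f where b: "biorth n v f" and Sv: "S \<subseteq> span (v ` {..<n})"
    using exists_biorth_spanning[OF S] .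
  \<comment> \<open>\<open>M\<close> bounds the sum of the coordinate norms of every
    \<open>x\<close> in \<open>S\<close>, so an error \<delta> at each \<open>v j\<close> causes an
    error of at most M \<delta> < \<epsilon> on \<open>S\<close>.\<close>
  define M where "M = (\<Sum>x\<in>S. \<Sum>i<n. norm (f i x))"
  define \<delta> where "\<delta> = \<epsilon> / (1 + M)"
  have M: "M \<ge> 0" by (simp add: M_def sum_nonneg)
  then have \<delta>: "\<delta> > 0" using \<epsilon> by (simp add: \<delta>_def)
  obtain v1 f1 where b1: "biorth (n + n) v1 f1" and v1: "\<forall>i<n. v1 i = v i"
    and near1: "\<forall>j<n. norm (v1 (n + j) - T (v j)) < \<delta>"
    using exists_biorth_near[OF inf b \<delta>, of n "\<lambda>j. T (v j)"] by blast
  obtain u h C where u: "\<And>i. i < n + n \<Longrightarrow> u i = v1 i" and bu: "\<And>n. biorth n u h" and C: "C > 0"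
    "\<And>n. norm (u n) \<le> C" "\<And>n x. norm (h n x) \<le> C * norm x"
    using exists_bounded_biorth_sequence[OF inf b1] by metis
  have h: "functional (h i)" for i using bu[of "Suc i"] by (simp add: biorth_def)
  have hu: "h i (u j) = (if i = j then 1 else 0)" for i j
    using bu[of "Suc (max i j)"] by (simp add: biorth_def)
  obtain c :: "nat \<Rightarrow> nat" and w :: "nat \<Rightarrow> 'k" where cw: "\<And>n. c n \<ge> 1"
    "filterlim c at_top sequentially" "\<And>n. norm (w n) \<le> 1"
    "\<And>z \<eta>. norm z \<le> 1 \<Longrightarrow> \<eta> > 0 \<Longrightarrow> \<exists>\<^sub>F n in sequentially. real (c n) * norm (z - w n) < \<eta>"
    using exists_weighted_approximation by blast
  \<comment> \<open>This formula exchanges \<open>u j\<close> with \<open>u (n + j)\<close> for j <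
    n without a complement to their span: it only adds multiples of the differences, and vectors
    whose first 2 n coordinates vanish stay fixed.\<close>
  define J where "J x = x + (\<Sum>j<n. sc (h j x - h (n + j) x) (u (n + j) - u j))" for x
  have J_linear: "bounded_linear J"
    unfolding J_def
    by (intro bounded_linear_add bounded_linear_ident bounded_linear_sum
        bounded_linear_compose[OF bounded_linear_sc_left] bounded_linear_sub functional_bounded_linear h)
  have J_sc: "J (sc r x) = sc r (J x)" for r x
    by (simp add: J_def functional_scale[OF h] scale_right_distrib scale_sum_right
        flip: right_diff_distrib)
  have J_u: "J (u i) = u i" if "n + n \<le> i" for i
    using that by (simp add: J_def hu)
  have J_swap: "J (u i) = u (n + i)" if "i < n" for i
  proof -
    have "(\<Sum>j<n. sc (h j (u i) - h (n + j) (u i)) (u (n + j) - u j))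
        = (\<Sum>j<n. if j = i then u (n + i) - u i else 0)"
      using that by (intro sum.cong) (auto simp: hu)
    then show ?thesis using that by (simp add: J_def)
  qed
  have h_J: "h l (J x) = h l x + (\<Sum>j<n. (h j x - h (n + j) x) * (h l (u (n + j)) - h l (u j)))" for l x
    by (simp add: J_def functional_add[OF h] functional_sum[OF h] functional_scale[OF h] functional_diff[OF h])
  have h_J_fix: "h l (J x) = h l x" if "n + n \<le> l" for l x
    using that by (simp add: h_J hu)
  have h_J1: "h l (J x) = h (n + l) x" if "l < n" for l x
  proof -
    have "(\<Sum>j<n. (h j x - h (n + j) x) * (h l (u (n + j)) - h l (u j)))
        = (\<Sum>j<n. if j = l then h (n + l) x - h l x else 0)"
      using that by (intro sum.cong) (auto simp: hu)
    then show ?thesis using that by (simp add: h_J)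
  qed
  have h_J2: "h (n + l) (J x) = h l x" if "l < n" for l x
  proof -
    have "(\<Sum>j<n. (h j x - h (n + j) x) * (h (n + l) (u (n + j)) - h (n + l) (u j)))
        = (\<Sum>j<n. if j = l then h l x - h (n + l) x else 0)"
      using that by (intro sum.cong) (auto simp: hu)
    then show ?thesis using that by (simp add: h_J)
  qed
  have J_J: "J (J x) = x" for x
  proof -
    have "J (J x) = J x + (\<Sum>j<n. sc (h (n + j) x - h j x) (u (n + j) - u j))"
      unfolding J_def[of "J x"] by (simp add: h_J1 h_J2)
    also have "\<dots> = x + ((\<Sum>j<n. sc (h j x - h (n + j) x) (u (n + j) - u j))
        + (\<Sum>j<n. sc (h (n + j) x - h j x) (u (n + j) - u j)))"
      by (simp add: J_def)
    also have "\<dots> = x" by (simp flip: sum.distrib scale_left_distrib)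
    finally show ?thesis .
  qed
  \<comment> \<open>The first 2 n indices belong to the swapped pairs, the next two to
    \<open>p\<close> and \<open>q\<close>, and the remaining ones alternate between the two vectors
    of the blocks.\<close>
  have "periodic_blocks sc (\<lambda>i. u (n + n + 2 + 2 * i)) (\<lambda>i. u (n + n + 3 + 2 * i))
    (\<lambda>i. h (n + n + 2 + 2 * i)) (\<lambda>i. h (n + n + 3 + 2 * i)) (h (n + n)) (h (n + n + 1))
    J C c w (u (n + n)) (u (n + n + 1))"
    by unfold_locales (simp_all add: h hu C J_sc J_J J_u h_J_fix cw cw(1)[simplified]
        linear_simps(1,5)[OF J_linear] bounded_linear.bounded[OF J_linear], presburger+)
  from periodic_blocks.exists_A_class_eq_J[OF this]
  obtain L where L_class: "L \<in> A_class sc" and L_J: "\<And>x. (\<And>i. h (n + n + 2 + 2 * i) x = 0) \<Longrightarrow>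
      (\<And>i. h (n + n + 3 + 2 * i) x = 0) \<Longrightarrow> h (n + n) x = 0 \<Longrightarrow> h (n + n + 1) x = 0 \<Longrightarrow>
      blinfun_apply L x = J x"
    by auto
  have near: "norm (blinfun_apply L (v j) - T (v j)) < \<delta>" if "j < n" for j
  proof -
    have "blinfun_apply L (u j) = J (u j)" by (rule L_J) (use that in \<open>simp_all add: hu\<close>)
    also have "\<dots> = u (n + j)" by (rule J_swap[OF that])
    finally have "blinfun_apply L (u j) = u (n + j)" .
    moreover have "u j = v j" "u (n + j) = v1 (n + j)" using u v1 that by auto
    ultimately show ?thesis using near1 that by simp
  qed
  have "norm (blinfun_apply L x - blinfun_apply T x) < \<epsilon>" if x: "x \<in> S" for x
  proof -
    have sc_LT: "L (sc r y) = sc r (L y)" "T (sc r y) = sc r (T y)" for r y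
      using L_class T by (auto simp: A_class_def bounded_ops_def)
    have "x = (\<Sum>i<n. sc (f i x) (v i))" using biorth_span_iff[OF b, of x] Sv x by blast
    then have "L x - T x = L (\<Sum>i<n. sc (f i x) (v i)) - T (\<Sum>i<n. sc (f i x) (v i))" by simp
    also have "\<dots> = (\<Sum>i<n. sc (f i x) (L (v i) - T (v i)))"
      by (simp add: blinfun.sum_right sc_LT scale_right_diff_distrib sum_subtractf)
    finally have "norm (blinfun_apply L x - blinfun_apply T x) \<le> (\<Sum>i<n. norm (sc (f i x) (L (v i) - T (v i))))"
      by (simp add: norm_sum)
    also have "\<dots> \<le> (\<Sum>i<n. norm (f i x) * \<delta>)"
      unfolding norm_scale by (intro sum_mono mult_left_mono) (auto intro: less_imp_le near)
    also have "\<dots> = (\<Sum>i<n. norm (f i x)) * \<delta>" by (simp add: sum_distrib_right)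
    also have "\<dots> \<le> M * \<delta>"
      unfolding M_def using \<delta> S x
      by (intro mult_right_mono member_le_sum[of x S "\<lambda>x. \<Sum>i<n. norm (f i x)"]) (auto intro: sum_nonneg)
    also have "\<dots> < \<epsilon>" using M \<epsilon> by (simp add: \<delta>_def field_simps)
    finally show ?thesis .
  qed
  then show ?thesis using L_class by blast
qed

theorem A_class_dense:
  assumes inf: "infinite_dim sc UNIV"
  shows "SOT sc closure_of A_class sc = bounded_ops sc"
proof -
  have top: "topspace (SOT sc) = bounded_ops sc"
    by (simp add: SOT_def strong_operator_topology_topspace)
  show ?thesis
  proof
    show "SOT sc closure_of A_class sc \<subseteq> bounded_ops sc"
      using closure_of_subset_topspace[of "SOT sc"] top by simp
    show "bounded_ops sc \<subseteq> SOT sc closure_of A_class sc"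
    proof
      fix T assume T: "T \<in> bounded_ops sc"
      have "\<exists>R. R \<in> A_class sc \<and> R \<in> U" if U: "T \<in> U" "openin (SOT sc) U" for U
      proof -
        obtain V where V: "openin strong_operator_topology V" "U = V \<inter> bounded_ops sc"
          using U(2) unfolding SOT_def openin_subtopology by blast
        have "T \<in> V" using U(1) V(2) by blast
        with V(1) obtain S \<epsilon> where S: "finite S" "\<epsilon> > 0"
          "\<And>R. (\<And>x. x \<in> S \<Longrightarrow>
      norm (blinfun_apply R x - blinfun_apply T x) < \<epsilon>) \<Longrightarrow> R \<in> V"
          by (rule strong_operator_neighbourhood) blast
        obtain R where "R \<in> A_class sc" "\<forall>x\<in>S. norm (blinfun_apply R x - blinfun_apply T x) < \<epsilon>"
          using A_class_approximates[OF inf T S(1,2)] by blast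
        then show ?thesis using S(3) V(2) by (auto simp: A_class_def)
      qed
      then show "T \<in> SOT sc closure_of A_class sc" unfolding in_closure_of top using T by blast
    qed
  qed
qed

end

theorem proposition5p3:
  fixes scaleC :: "complex \<Rightarrow> 'b::banach \<Rightarrow> 'b"
  shows "(infinite_dim (scaleR :: real \<Rightarrow> 'a \<Rightarrow> 'a) (UNIV :: 'a::banach set) \<and>
          sep_or_sep_complemented (scaleR :: real \<Rightarrow> 'a \<Rightarrow> 'a) \<longrightarrow>
            SOT (scaleR :: real \<Rightarrow> 'a \<Rightarrow> 'a) closure_of A_class (scaleR :: real \<Rightarrow> 'a \<Rightarrow> 'a)
              = bounded_ops (scaleR :: real \<Rightarrow> 'a \<Rightarrow> 'a))
       \<and> (normed_space_over scaleC \<and> infinite_dim scaleC (UNIV :: 'b set) \<and>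
          sep_or_sep_complemented scaleC \<longrightarrow>
            SOT scaleC closure_of A_class scaleC = bounded_ops scaleC)"
  using separated_space.A_class_dense[OF separated_space_real]
    separated_space.A_class_dense[OF complex_normed_space.separated[OF complex_normed_space.intro]]
  by blast

end
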